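(* Let $M\subset\mathbb{R}^4$ be a 3-dimensional complete connected smooth Riemannian manifold without boundary (with the metric induced from $\mathbb{R}^4$), and let $M$ be isometric to a Riemannian product $N\times\mathbb{R}$. Let $f:M\to\mathbb{R}$ be a non-trivial affine function and let $\alpha:I\to M$ be an $f$-eikonal helix curve, with Frenet frame $\{T,N,B\}$, curvature $\kappa>0$ and torsion $\tau$ in $M$. Then: (1) the axis $\nabla f$ of $\alpha$ is given along $\alpha$ by $$\nabla f=\|\nabla f\|\left(\cos(\theta)T+\sin(\theta)B\right),$$ where $\theta$ is constant; (2) $\dfrac{\tau}{\kappa}$ is constant along $\alpha$.
   Context: A function $f:M\to\mathbb{R}$ is affine if for each unit speed geodesic $\gamma:(-\infty,\infty)\to M$ there are constants $a,b\in\mathbb{R}$ such that $f(\gamma(s))=as+b$ for all $s$; non-trivial means non-constant. $\nabla f$ is the gradient of $f$ on $M$. A curve $\alpha$ on $M$ with unit tangent $T$ is an $f$-eikonal helix curve if $\|\nabla f\|$ is constant along $\alpha$ and the angle between $\nabla f$ and $T$ is constant along $\alpha$, i.e. $\langle\nabla f,T\rangle$ is constant along $\alpha$; $\nabla f$ is then called the axis of $\alpha$. For a curve in a 3-dimensional Riemannian manifold $M$ with Levi-Civita connection $\nabla$, the Frenet frame $\{T,N,B\}$ (orthonormal), curvature $\kappa$ (always assumed $>0$) and torsion $\tau$ satisfy $\nabla_TT=\kappa N$, $\nabla_TN=-\kappa T+\tau B$, $\nabla_TB=-\tau N$. (The letter $N$ denotes both the factor of the product and the principal normal field of $\alpha$.)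 *)

theory Defs
  imports "HOL-Analysis.Analysis"
begin

section \<open>Smooth maps between Euclidean spaces\<close>

text \<open>
  The class \<open>C\<^sup>k\<close> by iterated directional derivatives. Derivatives are taken within \<open>S\<close>, so
  for open \<open>S\<close> this is the ordinary notion, and for a nondegenerate real interval it is the
  ordinary notion with one-sided derivatives at the end points. It is only used for these two
  kinds of sets.
\<close>

primrec Ck_on :: "nat \<Rightarrow> 'a::euclidean_space set \<Rightarrow> ('a \<Rightarrow> 'b::euclidean_space) \<Rightarrow> bool" where
  "Ck_on 0 S F \<longleftrightarrow> continuous_on S F"
| "Ck_on (Suc k) S F \<longleftrightarrow>
     (\<forall>x\<in>S. F differentiable (at x within S)) \<and>
     (\<forall>v. Ck_on k S (\<lambda>x. frechet_derivative F (at x within S) v))"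

definition smooth_on :: "'a::euclidean_space set \<Rightarrow> ('a \<Rightarrow> 'b::euclidean_space) \<Rightarrow> bool" where
  "smooth_on S F \<longleftrightarrow> (\<forall>k. Ck_on k S F)"

text \<open>Smoothness on a subset \<open>S\<close> (typically a submanifold): local smooth extendability.\<close>

definition smooth_map :: "'a::euclidean_space set \<Rightarrow> ('a \<Rightarrow> 'b::euclidean_space) \<Rightarrow> bool" where
  "smooth_map S F \<longleftrightarrow>
     (\<forall>p\<in>S. \<exists>U G. open U \<and> p \<in> U \<and> smooth_on U G \<and> (\<forall>x\<in>U \<inter> S. G x = F x))"

section \<open>Submanifolds of Euclidean space with the induced metric\<close>

text \<open>The local slice condition: near each of its points, \<open>M\<close> is straightened to an open piece of
  a \<open>k\<close>-dimensional linear subspace by an ambient diffeomorphism.\<close>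

definition smooth_submanifold :: "nat \<Rightarrow> 'a::euclidean_space set \<Rightarrow> bool" where
  "smooth_submanifold k M \<longleftrightarrow>
     (\<forall>p\<in>M. \<exists>U V \<phi> \<psi> L. open U \<and> p \<in> U \<and> open (V :: 'a set) \<and>
        homeomorphism U V \<phi> \<psi> \<and> smooth_on U \<phi> \<and> smooth_on V \<psi> \<and>
        subspace L \<and> dim L = k \<and> \<phi> ` (U \<inter> M) = V \<inter> L)"

definition curve_germ ::
    "'a::euclidean_space set \<Rightarrow> 'a \<Rightarrow> 'a \<Rightarrow> (real \<Rightarrow> 'a) \<Rightarrow> bool" where
  "curve_germ M p v \<gamma> \<longleftrightarrow>
     (\<exists>\<epsilon>>0. smooth_on {-\<epsilon><..<\<epsilon>} \<gamma> \<and> \<gamma> ` {-\<epsilon><..<\<epsilon>} \<subseteq> M) \<and>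
     \<gamma> 0 = p \<and> (\<gamma> has_vector_derivative v) (at 0)"

definition tangent_space :: "'a::euclidean_space set \<Rightarrow> 'a \<Rightarrow> 'a set" where
  "tangent_space M p = {v. \<exists>\<gamma>. curve_germ M p v \<gamma>}"

definition grad :: "'a::euclidean_space set \<Rightarrow> ('a \<Rightarrow> real) \<Rightarrow> 'a \<Rightarrow> 'a" where
  "grad M f p = (THE g. g \<in> tangent_space M p \<and>
     (\<forall>v \<gamma>. curve_germ M p v \<gamma> \<longrightarrow> ((\<lambda>t. f (\<gamma> t)) has_real_derivative g \<bullet> v) (at 0)))"

definition tangential_part :: "'a::euclidean_space set \<Rightarrow> 'a \<Rightarrow> 'a \<Rightarrow> 'a" where
  "tangential_part M p w =
     (THE v. v \<in> tangent_space M p \<and> (\<forall>u\<in>tangent_space M p. (w - v) \<bullet> u = 0))"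

definition velocity :: "real set \<Rightarrow> (real \<Rightarrow> 'a::euclidean_space) \<Rightarrow> real \<Rightarrow> 'a" where
  "velocity I \<alpha> t = vector_derivative \<alpha> (at t within I)"

text \<open>
  Covariant derivative \<open>DX/dt\<close> of a tangent field \<open>X\<close> along a curve \<open>\<alpha>\<close> in \<open>M\<close>. For the metric
  induced from the ambient Euclidean space, the Levi-Civita connection of \<open>M\<close> is the tangential
  part of the flat ambient derivative.
\<close>

definition cov_deriv ::
    "'a::euclidean_space set \<Rightarrow> real set \<Rightarrow> (real \<Rightarrow> 'a) \<Rightarrow> (real \<Rightarrow> 'a) \<Rightarrow> real \<Rightarrow> 'a" where
  "cov_deriv M I \<alpha> X t = tangential_part M (\<alpha> t) (vector_derivative X (at t within I))"

definition geodesic_line :: "'a::euclidean_space set \<Rightarrow> (real \<Rightarrow> 'a) \<Rightarrow> bool" where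
  "geodesic_line M \<gamma> \<longleftrightarrow> smooth_on UNIV \<gamma> \<and> range \<gamma> \<subseteq> M \<and>
     (\<forall>t. cov_deriv M UNIV \<gamma> (velocity UNIV \<gamma>) t = 0)"

definition unit_speed_geodesic_line :: "'a::euclidean_space set \<Rightarrow> (real \<Rightarrow> 'a) \<Rightarrow> bool" where
  "unit_speed_geodesic_line M \<gamma> \<longleftrightarrow>
     geodesic_line M \<gamma> \<and> (\<forall>t. norm (velocity UNIV \<gamma> t) = 1)"

text \<open>
  Completeness of \<open>M\<close> as a Riemannian manifold: every exponential map \<open>exp\<^sub>p\<close> is defined on the
  whole tangent space. This is intrinsic; it differs from the library's \<^const>\<open>complete\<close>, which
  refers to the ambient distance (a complete embedded submanifold need not be closed).
\<close>

definition geodesically_complete :: "'a::euclidean_space set \<Rightarrow> bool" where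
  "geodesically_complete M \<longleftrightarrow>
     (\<forall>p\<in>M. \<forall>v\<in>tangent_space M p. \<exists>\<gamma>. geodesic_line M \<gamma> \<and> \<gamma> 0 = p \<and> velocity UNIV \<gamma> 0 = v)"

definition affine_function :: "'a::euclidean_space set \<Rightarrow> ('a \<Rightarrow> real) \<Rightarrow> bool" where
  "affine_function M f \<longleftrightarrow>
     (\<forall>\<gamma>. unit_speed_geodesic_line M \<gamma> \<longrightarrow> (\<exists>a b. \<forall>s. f (\<gamma> s) = a * s + b))"

section \<open>Curves, helices and Frenet frames\<close>

definition regular_curve :: "'a::euclidean_space set \<Rightarrow> real set \<Rightarrow> (real \<Rightarrow> 'a) \<Rightarrow> bool" where
  "regular_curve M I \<alpha> \<longleftrightarrow> is_interval I \<and> interior I \<noteq> {} \<and>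
     smooth_on I \<alpha> \<and> \<alpha> ` I \<subseteq> M \<and> (\<forall>t\<in>I. velocity I \<alpha> t \<noteq> 0)"

definition unit_tangent :: "real set \<Rightarrow> (real \<Rightarrow> 'a::euclidean_space) \<Rightarrow> real \<Rightarrow> 'a" where
  "unit_tangent I \<alpha> t = velocity I \<alpha> t /\<^sub>R norm (velocity I \<alpha> t)"

definition eikonal_helix ::
    "'a::euclidean_space set \<Rightarrow> ('a \<Rightarrow> real) \<Rightarrow> real set \<Rightarrow> (real \<Rightarrow> 'a) \<Rightarrow> bool" where
  "eikonal_helix M f I \<alpha> \<longleftrightarrow> regular_curve M I \<alpha> \<and>
     (\<lambda>t. norm (grad M f (\<alpha> t))) constant_on I \<and>
     (\<lambda>t. grad M f (\<alpha> t) \<bullet> unit_tangent I \<alpha> t) constant_on I"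

text \<open>The derivative \<open>\<nabla>\<^sub>T X\<close> in the direction of the unit tangent, that is, with respect to arc
  length; the curve itself need not have unit speed.\<close>

definition nabla_T ::
    "'a::euclidean_space set \<Rightarrow> real set \<Rightarrow> (real \<Rightarrow> 'a) \<Rightarrow> (real \<Rightarrow> 'a) \<Rightarrow> real \<Rightarrow> 'a" where
  "nabla_T M I \<alpha> X t = cov_deriv M I \<alpha> X t /\<^sub>R norm (velocity I \<alpha> t)"

text \<open>\<open>Nn\<close> and \<open>Bn\<close> are the principal normal and the binormal. No orientation of \<open>M\<close> is fixed, so
  both choices of \<open>Bn\<close> (with the corresponding sign of \<open>\<tau>\<close>) are admitted.\<close>

definition frenet_apparatus ::
    "'a::euclidean_space set \<Rightarrow> real set \<Rightarrow> (real \<Rightarrow> 'a) \<Rightarrow> (real \<Rightarrow> 'a) \<Rightarrow> (real \<Rightarrow> 'a) \<Rightarrow>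
     (real \<Rightarrow> 'a) \<Rightarrow> (real \<Rightarrow> real) \<Rightarrow> (real \<Rightarrow> real) \<Rightarrow> bool" where
  "frenet_apparatus M I \<alpha> T Nn Bn \<kappa> \<tau> \<longleftrightarrow>
     smooth_on I T \<and> smooth_on I Nn \<and> smooth_on I Bn \<and>
     (\<forall>t\<in>I. T t = unit_tangent I \<alpha> t \<and>
        Nn t \<in> tangent_space M (\<alpha> t) \<and> Bn t \<in> tangent_space M (\<alpha> t) \<and>
        norm (Nn t) = 1 \<and> norm (Bn t) = 1 \<and>
        T t \<bullet> Nn t = 0 \<and> T t \<bullet> Bn t = 0 \<and> Nn t \<bullet> Bn t = 0 \<and>
        \<kappa> t > 0 \<and>
        nabla_T M I \<alpha> T t = \<kappa> t *\<^sub>R Nn t \<and>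
        nabla_T M I \<alpha> Nn t = - \<kappa> t *\<^sub>R T t + \<tau> t *\<^sub>R Bn t \<and>
        nabla_T M I \<alpha> Bn t = - \<tau> t *\<^sub>R Nn t)"

section \<open>Abstract Riemannian manifolds and products with a line\<close>

text \<open>
  A Riemannian chart \<open>(U, x, g)\<close> consists of a parametrization \<open>x : U \<rightarrow> X\<close> on a subset of the model
  space \<open>'e\<close> (whose dimension is that of the manifold) and the coordinate expression
  \<open>g u v w\<close> of the metric at \<open>x u\<close> on the coordinate vectors \<open>v\<close>, \<open>w\<close>.
\<close>

type_synonym ('e, 'p) rchart = "'e set \<times> ('e \<Rightarrow> 'p) \<times> ('e \<Rightarrow> 'e \<Rightarrow> 'e \<Rightarrow> real)"

definition riemannian_chart ::
    "'p topology \<Rightarrow> ('e::euclidean_space, 'p) rchart \<Rightarrow> bool" where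
  "riemannian_chart X = (\<lambda>(U, x, g).
     open U \<and> openin X (x ` U) \<and>
     homeomorphic_map (top_of_set U) (subtopology X (x ` U)) x \<and>
     (\<forall>u\<in>U. bilinear (g u) \<and> (\<forall>v w. g u v w = g u w v) \<and> (\<forall>v. v \<noteq> 0 \<longrightarrow> g u v v > 0)) \<and>
     (\<forall>v w. smooth_on U (\<lambda>u. g u v w)))"

definition compatible_charts ::
    "('e::euclidean_space, 'p) rchart \<Rightarrow> ('e, 'p) rchart \<Rightarrow> bool" where
  "compatible_charts = (\<lambda>(U, x, g) (V, y, h).
     (let W = {u\<in>U. x u \<in> y ` V}; \<sigma> = (\<lambda>u. inv_into V y (x u)) in
        smooth_on W \<sigma> \<and>
        (\<forall>u\<in>W. \<forall>v w.
           h (\<sigma> u) (frechet_derivative \<sigma> (at u) v) (frechet_derivative \<sigma> (at u) w) = g u v w)))"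

definition riemannian_manifold ::
    "'p topology \<Rightarrow> ('e::euclidean_space, 'p) rchart set \<Rightarrow> bool" where
  "riemannian_manifold X A \<longleftrightarrow>
     Hausdorff_space X \<and>
     (\<exists>\<B>. countable \<B> \<and> (\<forall>B\<in>\<B>. openin X B) \<and>
        (\<forall>W. openin X W \<longrightarrow> (\<exists>\<U>\<subseteq>\<B>. \<Union>\<U> = W))) \<and>
     topspace X = (\<Union>(U, x, g)\<in>A. x ` U) \<and>
     (\<forall>c\<in>A. riemannian_chart X c) \<and>
     (\<forall>c\<in>A. \<forall>d\<in>A. compatible_charts c d)"

text \<open>The atlas of the Riemannian product with \<open>\<real>\<close>, whose metric is \<open>g + dt\<^sup>2\<close>. The underlying
  space is \<open>prod_topology X euclideanreal\<close>.\<close>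

definition times_line_atlas ::
    "('e::euclidean_space, 'p) rchart set \<Rightarrow> ('e \<times> real, 'p \<times> real) rchart set" where
  "times_line_atlas A =
     (\<lambda>(U, x, g). (U \<times> UNIV,
        (\<lambda>(u, t). (x u, t)),
        (\<lambda>(u, t) (v, r) (w, s). g u v w + r * s))) ` A"

text \<open>\<open>\<Phi>\<close> is a diffeomorphism onto the submanifold \<open>M\<close> that pulls the induced metric back to the
  given one; all conditions are expressed in the charts.\<close>

definition isometry_onto_submanifold ::
    "'p topology \<Rightarrow> ('e::euclidean_space, 'p) rchart set \<Rightarrow> 'a::euclidean_space set \<Rightarrow>
     ('p \<Rightarrow> 'a) \<Rightarrow> bool" where
  "isometry_onto_submanifold X A M \<Phi> \<longleftrightarrow>
     homeomorphic_map X (top_of_set M) \<Phi> \<and>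
     (\<forall>(U, x, g)\<in>A.
        smooth_on U (\<Phi> \<circ> x) \<and>
        smooth_map (\<Phi> ` x ` U) (inv_into U (\<Phi> \<circ> x)) \<and>
        (\<forall>u\<in>U. \<forall>v w.
           frechet_derivative (\<Phi> \<circ> x) (at u) v \<bullet> frechet_derivative (\<Phi> \<circ> x) (at u) w = g u v w))"

definition isometric_to_times_line ::
    "'a::euclidean_space set \<Rightarrow> 'p topology \<Rightarrow> ('e::euclidean_space, 'p) rchart set \<Rightarrow> bool" where
  "isometric_to_times_line M X A \<longleftrightarrow>
     (\<exists>\<Phi>. isometry_onto_submanifold (prod_topology X euclideanreal) (times_line_atlas A) M \<Phi>)"

end

theory Submission
  imports Defs
begin

text \<open>
  Since the restriction of \<open>f\<close> to every geodesic line is affine, its Hessian vanishes on the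
  diagonal, hence everywhere, so \<open>\<nabla>f\<close> is parallel; by connectedness its norm is a constant, which
  is nonzero because \<open>f\<close> is not constant. Differentiating \<open>\<langle>\<nabla>f, T\<rangle> = const\<close> along the helix gives
  \<open>\<langle>\<nabla>f, N\<rangle> = 0\<close>; differentiating this and \<open>\<langle>\<nabla>f, B\<rangle>\<close> gives \<open>\<kappa>\<langle>\<nabla>f, T\<rangle> = \<tau>\<langle>\<nabla>f, B\<rangle>\<close> with
  \<open>\<langle>\<nabla>f, B\<rangle>\<close> constant, and nonzero because otherwise \<open>\<nabla>f\<close> would vanish.
  To avoid differentiating the tangential projection, the Hessian at a point is computed from an
  ambient extension of \<open>f\<close> whose Euclidean gradient at that point is tangent to \<open>M\<close>.
\<close>

section \<open>Smooth maps and second derivatives\<close>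

text \<open>All derivatives are taken within \<open>S\<close>, so values outside \<open>S\<close>
  never enter. This lets a computed derivative be substituted under the recursion of
  \<open>Ck_on\<close>.\<close>

lemma Ck_on_cong:
  assumes "\<And>x. x \<in> S \<Longrightarrow> F x = G x"
  shows "Ck_on k S F \<longleftrightarrow> Ck_on k S G"
  using assms
proof (induction k arbitrary: F G)
  case 0
  then show ?case by (auto intro: continuous_on_cong)
next
  case (Suc k)
  have der: "(F has_derivative D) (at x within S) \<longleftrightarrow> (G has_derivative D) (at x within S)"
    if "x \<in> S" for x D
    using that Suc.prems has_derivative_transform[of x S F G D] has_derivative_transform[of x S G F D]
    by metis
  have fr: "frechet_derivative F (at x within S) = frechet_derivative G (at x within S)"
    if "x \<in> S" for x
    using der[OF that] by (simp add: frechet_derivative_def)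
  have "Ck_on k S (\<lambda>x. frechet_derivative F (at x within S) v) \<longleftrightarrow>
        Ck_on k S (\<lambda>x. frechet_derivative G (at x within S) v)" for v
    by (rule Suc.IH) (simp add: fr)
  moreover have "F differentiable (at x within S) \<longleftrightarrow> G differentiable (at x within S)"
    if "x \<in> S" for x
    using der[OF that] by (simp add: differentiable_def)
  ultimately show ?case by simp
qed

lemma Ck_on_Suc_open:
  assumes "open S"
  shows "Ck_on (Suc k) S F \<longleftrightarrow>
    (\<forall>x\<in>S. F differentiable (at x)) \<and> (\<forall>v. Ck_on k S (\<lambda>x. frechet_derivative F (at x) v))"
proof -
  have "Ck_on k S (\<lambda>x. frechet_derivative F (at x within S) v) \<longleftrightarrow>
        Ck_on k S (\<lambda>x. frechet_derivative F (at x) v)" for v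
    by (rule Ck_on_cong) (simp add: at_within_open[OF _ assms])
  moreover have "F differentiable (at x within S) \<longleftrightarrow> F differentiable (at x)" if "x \<in> S" for x
    by (simp add: at_within_open[OF that assms])
  ultimately show ?thesis by simp
qed

lemma smooth_on_differentiable:
  "smooth_on S F \<Longrightarrow> x \<in> S \<Longrightarrow> F differentiable (at x within S)"
  unfolding smooth_on_def using Ck_on.simps(2)[of 0 S F] by blast

lemma smooth_on_has_derivative:
  assumes "smooth_on S F" "open S" "x \<in> S"
  shows "(F has_derivative frechet_derivative F (at x)) (at x)"
  using smooth_on_differentiable[OF assms(1,3)] at_within_open[OF assms(3,2)]
  by (simp add: frechet_derivative_works)

lemma smooth_on_frechet_derivative:
  assumes "smooth_on S F" "open S"
  shows "smooth_on S (\<lambda>x. frechet_derivative F (at x) v)"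
  using assms Ck_on_Suc_open unfolding smooth_on_def by blast

lemma smooth_on_continuous_on: "smooth_on S F \<Longrightarrow> continuous_on S F"
  unfolding smooth_on_def using Ck_on.simps(1) by blast

lemma smooth_on_has_vector_derivative:
  assumes "smooth_on I F" "t \<in> I"
  shows "(F has_vector_derivative vector_derivative F (at t within I)) (at t within I)"
  using smooth_on_differentiable[OF assms] vector_derivative_works by blast

text \<open>The curves that realize tangent vectors will be \<psi> applied to straight lines, so
  affine lines are the inner maps needed. The induction closes because the derivative is again a map
  of class \<open>Ck_on k\<close> composed with the same line.\<close>

lemma Ck_on_compose_line:
  fixes F :: "'a::euclidean_space \<Rightarrow> 'b::euclidean_space"
  assumes "open S" "open J" "\<And>t. t \<in> J \<Longrightarrow> a + t *\<^sub>R v \<in> S" "Ck_on k S F"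
  shows "Ck_on k J (\<lambda>t::real. F (a + t *\<^sub>R v))"
  using assms(4)
proof (induction k arbitrary: F)
  case 0
  show ?case
    using 0 assms(3)
    by (auto intro!: continuous_on_compose2[of S F] continuous_intros)
next
  case (Suc k)
  have der: "((\<lambda>t. F (a + t *\<^sub>R v)) has_derivative
      (\<lambda>h. frechet_derivative F (at (a + t *\<^sub>R v)) (h *\<^sub>R v))) (at t)"
    if "t \<in> J" for t
  proof -
    have F: "(F has_derivative frechet_derivative F (at (a + t *\<^sub>R v))) (at (a + t *\<^sub>R v))"
      using Suc.prems assms(3)[OF that] Ck_on_Suc_open[OF assms(1)] frechet_derivative_works
      by blast
    have "((\<lambda>t. a + t *\<^sub>R v) has_derivative (\<lambda>h. h *\<^sub>R v)) (at t)"
      by (auto intro!: derivative_eq_intros)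
    from has_derivative_compose[OF this F] show ?thesis .
  qed
  show ?case
    unfolding Ck_on_Suc_open[OF assms(2)]
  proof (intro conjI ballI allI)
    fix t assume "t \<in> J"
    then show "(\<lambda>t. F (a + t *\<^sub>R v)) differentiable (at t)"
      using der differentiableI by blast
  next
    fix s :: real
    have "Ck_on k S (\<lambda>x. frechet_derivative F (at x) (s *\<^sub>R v))"
      using Suc.prems Ck_on_Suc_open[OF assms(1)] by blast
    from Suc.IH[OF this]
    have "Ck_on k J (\<lambda>t. frechet_derivative F (at (a + t *\<^sub>R v)) (s *\<^sub>R v))" .
    moreover have "frechet_derivative (\<lambda>t. F (a + t *\<^sub>R v)) (at t) s =
        frechet_derivative F (at (a + t *\<^sub>R v)) (s *\<^sub>R v)" if "t \<in> J" for t
      using frechet_derivative_at[OF der[OF that]] by metis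
    ultimately show "Ck_on k J (\<lambda>t. frechet_derivative (\<lambda>t. F (a + t *\<^sub>R v)) (at t) s)"
      by (subst Ck_on_cong)
  qed
qed

lemma Ck_on_bounded_linear_compose:
  assumes "open S" "bounded_linear A" "Ck_on k S F"
  shows "Ck_on k S (\<lambda>x. A (F x))"
  using assms(3)
proof (induction k arbitrary: F)
  case 0
  then show ?case
    using bounded_linear.continuous_on[OF assms(2)] by simp
next
  case (Suc k)
  have der: "((\<lambda>x. A (F x)) has_derivative (\<lambda>h. A (frechet_derivative F (at x) h))) (at x)"
    if "x \<in> S" for x
    using Suc.prems that Ck_on_Suc_open[OF assms(1)] frechet_derivative_works
      bounded_linear.has_derivative[OF assms(2)] by blast
  have "Ck_on k S (\<lambda>x. frechet_derivative (\<lambda>x. A (F x)) (at x) v) \<longleftrightarrow>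
        Ck_on k S (\<lambda>x. A (frechet_derivative F (at x) v))" for v
    by (rule Ck_on_cong) (simp add: frechet_derivative_at[OF der, symmetric])
  moreover have "Ck_on k S (\<lambda>x. A (frechet_derivative F (at x) v))" for v
    using Suc Ck_on_Suc_open[OF assms(1)] by blast
  moreover have "(\<lambda>x. A (F x)) differentiable (at x)" if "x \<in> S" for x
    using der[OF that] differentiableI by blast
  ultimately show ?case
    by (simp only: Ck_on_Suc_open[OF assms(1)]) blast
qed

lemma Ck_on_diff:
  assumes "open S" "Ck_on k S F" "Ck_on k S G"
  shows "Ck_on k S (\<lambda>x. F x - G x)"
  using assms(2,3)
proof (induction k arbitrary: F G)
  case 0
  then show ?case by (simp add: continuous_on_diff)
next
  case (Suc k)
  have der: "((\<lambda>x. F x - G x) has_derivative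
      (\<lambda>h. frechet_derivative F (at x) h - frechet_derivative G (at x) h)) (at x)"
    if "x \<in> S" for x
    using Suc.prems that Ck_on_Suc_open[OF assms(1)] frechet_derivative_works
      has_derivative_diff by blast
  have "Ck_on k S (\<lambda>x. frechet_derivative (\<lambda>x. F x - G x) (at x) v) \<longleftrightarrow>
        Ck_on k S (\<lambda>x. frechet_derivative F (at x) v - frechet_derivative G (at x) v)" for v
    by (rule Ck_on_cong) (simp add: frechet_derivative_at[OF der, symmetric])
  moreover have "Ck_on k S (\<lambda>x. frechet_derivative F (at x) v - frechet_derivative G (at x) v)" for v
    using Suc Ck_on_Suc_open[OF assms(1)] by blast
  moreover have "(\<lambda>x. F x - G x) differentiable (at x)" if "x \<in> S" for x
    using der[OF that] differentiableI by blast
  ultimately show ?case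
    by (simp only: Ck_on_Suc_open[OF assms(1)]) blast
qed

lemma Ck_on_open_subset:
  assumes "open S" "open S'" "S' \<subseteq> S" "Ck_on k S F"
  shows "Ck_on k S' F"
  using assms(4)
proof (induction k arbitrary: F)
  case 0
  then show ?case using assms(3) continuous_on_subset by auto
next
  case (Suc k)
  then show ?case
    unfolding Ck_on_Suc_open[OF assms(1)] Ck_on_Suc_open[OF assms(2)] using assms(3) by blast
qed

section \<open>Symmetry of second derivatives\<close>

text \<open>Two mean value steps on a small parallelogram: first along \<open>u\<close> for the
  difference of \<open>G\<close> between the two sides parallel to \<open>u\<close>, then along
  \<open>v\<close> for the directional derivative \<open>D y u\<close>.\<close>

lemma second_difference_mean_value:
  fixes G :: "'a::real_normed_vector \<Rightarrow> real"
  assumes h: "h > 0"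
    and mem: "\<And>s t. \<lbrakk>0 \<le> s; s \<le> h; 0 \<le> t; t \<le> h\<rbrakk> \<Longrightarrow> x + s *\<^sub>R u + t *\<^sub>R v \<in> U"
    and D: "\<And>y. y \<in> U \<Longrightarrow> (G has_derivative D y) (at y)"
    and D2: "\<And>y. y \<in> U \<Longrightarrow> ((\<lambda>y. D y u) has_derivative D2 y) (at y)"
  shows "\<exists>s t. 0 \<le> s \<and> s \<le> h \<and> 0 \<le> t \<and> t \<le> h \<and>
    G (x + h *\<^sub>R u + h *\<^sub>R v) - G (x + h *\<^sub>R u) - G (x + h *\<^sub>R v) + G x =
    h\<^sup>2 * D2 (x + s *\<^sub>R u + t *\<^sub>R v) v"
proof -
  define \<phi> where "\<phi> s = G (x + s *\<^sub>R u + h *\<^sub>R v) - G (x + s *\<^sub>R u + 0 *\<^sub>R v)" for s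
  have lin: "D y (r *\<^sub>R w) = r * D y w" "D2 y (r *\<^sub>R w) = r * D2 y w" if "y \<in> U" for y r w
    using linear_scale[OF has_derivative_linear[OF D[OF that]]]
      linear_scale[OF has_derivative_linear[OF D2[OF that]]] by auto
  have dG: "((\<lambda>s. G (x + s *\<^sub>R u + t *\<^sub>R v)) has_derivative
      (\<lambda>r. r * D (x + s *\<^sub>R u + t *\<^sub>R v) u)) (at s within {0..h})"
    if "0 \<le> s" "s \<le> h" "0 \<le> t" "t \<le> h" for s t
  proof -
    have m: "x + s *\<^sub>R u + t *\<^sub>R v \<in> U" using mem that by blast
    have "((\<lambda>s. x + s *\<^sub>R u + t *\<^sub>R v) has_derivative (\<lambda>r. r *\<^sub>R u)) (at s within {0..h})"
      by (auto intro!: derivative_eq_intros)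
    from has_derivative_compose[OF this D[OF m]] show ?thesis by (simp add: lin[OF m])
  qed
  have "\<exists>s\<in>{0<..<h}. \<phi> h - \<phi> 0 =
      (h - 0) * D (x + s *\<^sub>R u + h *\<^sub>R v) u - (h - 0) * D (x + s *\<^sub>R u + 0 *\<^sub>R v) u"
    unfolding \<phi>_def using h
    by (intro mvt_simple[OF h]) (auto intro!: has_derivative_diff dG[simplified] dG[of _ 0, simplified])
  then obtain s where s: "0 < s" "s < h"
    and 1: "\<phi> h - \<phi> 0 = h * (D (x + s *\<^sub>R u + h *\<^sub>R v) u - D (x + s *\<^sub>R u + 0 *\<^sub>R v) u)"
    by (auto simp: algebra_simps)
  have dD: "((\<lambda>t. D (x + s *\<^sub>R u + t *\<^sub>R v) u) has_derivative
      (\<lambda>r. r * D2 (x + s *\<^sub>R u + t *\<^sub>R v) v)) (at t within {0..h})"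
    if "0 \<le> t" "t \<le> h" for t
  proof -
    have m: "x + s *\<^sub>R u + t *\<^sub>R v \<in> U" using mem that s by simp
    have "((\<lambda>t. x + s *\<^sub>R u + t *\<^sub>R v) has_derivative (\<lambda>r. r *\<^sub>R v)) (at t within {0..h})"
      by (auto intro!: derivative_eq_intros)
    from has_derivative_compose[OF this D2[OF m]] show ?thesis by (simp add: lin[OF m])
  qed
  have "\<exists>t\<in>{0<..<h}. D (x + s *\<^sub>R u + h *\<^sub>R v) u - D (x + s *\<^sub>R u + 0 *\<^sub>R v) u =
      (h - 0) * D2 (x + s *\<^sub>R u + t *\<^sub>R v) v"
    by (rule mvt_simple[OF h dD])
  then obtain t where t: "0 < t" "t < h"
    and 2: "D (x + s *\<^sub>R u + h *\<^sub>R v) u - D (x + s *\<^sub>R u + 0 *\<^sub>R v) u =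
      h * D2 (x + s *\<^sub>R u + t *\<^sub>R v) v"
    by auto
  have "G (x + h *\<^sub>R u + h *\<^sub>R v) - G (x + h *\<^sub>R u) - G (x + h *\<^sub>R v) + G x = \<phi> h - \<phi> 0"
    by (simp add: \<phi>_def)
  also have "\<dots> = h\<^sup>2 * D2 (x + s *\<^sub>R u + t *\<^sub>R v) v"
    unfolding 1 2 by (simp add: power2_eq_square)
  finally show ?thesis using s t by (metis less_imp_le)
qed

text \<open>The second difference of \<open>G\<close> is unchanged when \<open>u\<close> and
  \<open>v\<close> are swapped. Its mean value form in both orders equates the two mixed derivatives
  at two points near \<open>x\<close>, and by continuity they cannot differ at
  \<open>x\<close>.\<close>

lemma second_derivative_symmetric:
  fixes G :: "'a::real_normed_vector \<Rightarrow> real"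
  assumes U: "open U" "x \<in> U"
    and D: "\<And>y. y \<in> U \<Longrightarrow> (G has_derivative D y) (at y)"
    and D2: "\<And>y v. y \<in> U \<Longrightarrow> ((\<lambda>y. D y v) has_derivative D2 v y) (at y)"
    and cont: "\<And>v w. continuous_on U (\<lambda>y. D2 v y w)"
  shows "D2 u x v = D2 v x u"
proof (rule ccontr)
  assume neq: "D2 u x v \<noteq> D2 v x u"
  define e where "e = \<bar>D2 u x v - D2 v x u\<bar> / 2"
  have "e > 0" using neq by (simp add: e_def)
  have near: "\<exists>d>0. \<forall>y. dist y x < d \<longrightarrow> dist (D2 a y b) (D2 a x b) < e" for a b
  proof -
    have "isCont (\<lambda>y. D2 a y b) x"
      using cont U continuous_on_eq_continuous_at by blast
    then show ?thesis
      using \<open>e > 0\<close> unfolding continuous_at_eps_delta by blast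
  qed
  obtain d1 where d1: "d1 > 0" "\<And>y. dist y x < d1 \<Longrightarrow> dist (D2 u y v) (D2 u x v) < e"
    using near by blast
  obtain d2 where d2: "d2 > 0" "\<And>y. dist y x < d2 \<Longrightarrow> dist (D2 v y u) (D2 v x u) < e"
    using near by blast
  obtain d3 where d3: "d3 > 0" "ball x d3 \<subseteq> U"
    using U openE by blast
  define d where "d = min d1 (min d2 d3)"
  have d: "d > 0" "d \<le> d1" "d \<le> d2" "d \<le> d3" using d1 d2 d3 by (auto simp: d_def)
  \<comment> \<open>This side length keeps the parallelogram within distance \<open>d\<close> of
    \<open>x\<close>; the summand 1 covers \<open>u = v = 0\<close>.\<close>
  define h where "h = d / (2 * (norm u + norm v + 1))"
  have nz: "norm u + norm v + 1 > 0"
    by (simp add: add_nonneg_pos)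
  then have h: "h > 0" using d by (simp add: h_def)
  have hd: "h * (norm u + norm v) < d"
  proof -
    have "h * (norm u + norm v) < h * (2 * (norm u + norm v + 1))"
      using h by (intro mult_strict_left_mono) (auto simp: add_nonneg_pos)
    also have "\<dots> = d" using nz by (simp add: h_def)
    finally show ?thesis .
  qed
  have close: "dist (x + s *\<^sub>R u + t *\<^sub>R v) x < d" if "0 \<le> s" "s \<le> h" "0 \<le> t" "t \<le> h" for s t
  proof -
    have "dist (x + s *\<^sub>R u + t *\<^sub>R v) x \<le> s * norm u + t * norm v"
      using norm_triangle_ineq[of "s *\<^sub>R u" "t *\<^sub>R v"] that by (simp add: dist_norm)
    also have "\<dots> \<le> h * norm u + h * norm v"
      using that by (intro add_mono mult_right_mono) auto
    finally show ?thesis using hd by (simp add: algebra_simps)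
  qed
  have mem: "x + s *\<^sub>R u + t *\<^sub>R v \<in> U" if "0 \<le> s" "s \<le> h" "0 \<le> t" "t \<le> h" for s t
    using close[OF that] d d3 by (auto simp: dist_commute)
  obtain s t where st: "0 \<le> s" "s \<le> h" "0 \<le> t" "t \<le> h"
    and 1: "G (x + h *\<^sub>R u + h *\<^sub>R v) - G (x + h *\<^sub>R u) - G (x + h *\<^sub>R v) + G x =
      h\<^sup>2 * D2 u (x + s *\<^sub>R u + t *\<^sub>R v) v"
    using second_difference_mean_value[OF h mem D D2] by blast
  have mem': "x + s *\<^sub>R v + t *\<^sub>R u \<in> U" if "0 \<le> s" "s \<le> h" "0 \<le> t" "t \<le> h" for s t
    using mem[of t s] that by (simp add: ac_simps)
  obtain t' s' where st': "0 \<le> s'" "s' \<le> h" "0 \<le> t'" "t' \<le> h"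
    and 2: "G (x + h *\<^sub>R v + h *\<^sub>R u) - G (x + h *\<^sub>R v) - G (x + h *\<^sub>R u) + G x =
      h\<^sup>2 * D2 v (x + t' *\<^sub>R v + s' *\<^sub>R u) u"
    using second_difference_mean_value[OF h mem' D D2] by blast
  have "h\<^sup>2 * D2 u (x + s *\<^sub>R u + t *\<^sub>R v) v = h\<^sup>2 * D2 v (x + s' *\<^sub>R u + t' *\<^sub>R v) u"
    using 1 2 by (simp add: algebra_simps)
  then have eq: "D2 u (x + s *\<^sub>R u + t *\<^sub>R v) v = D2 v (x + s' *\<^sub>R u + t' *\<^sub>R v) u"
    using h by simp
  have "dist (D2 u (x + s *\<^sub>R u + t *\<^sub>R v) v) (D2 u x v) < e"
    using close[OF st] d d1 by (meson less_le_trans)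
  moreover have "dist (D2 v (x + s' *\<^sub>R u + t' *\<^sub>R v) u) (D2 v x u) < e"
    using close[OF st'] d d2 by (meson less_le_trans)
  ultimately show False
    using eq by (simp add: e_def dist_real_def abs_if split: if_splits)
qed

section \<open>Euclidean gradient and Hessian\<close>

text \<open>The derivative is turned into a vector so that it can be compared with tangent vectors
  and differentiated as an ambient field.\<close>

definition euclidean_gradient :: "('a::euclidean_space \<Rightarrow> real) \<Rightarrow> 'a \<Rightarrow> 'a" where
  "euclidean_gradient G x = (\<Sum>b\<in>Basis. frechet_derivative G (at x) b *\<^sub>R b)"

lemma euclidean_gradient_inner:
  assumes "G differentiable (at x)"
  shows "euclidean_gradient G x \<bullet> v = frechet_derivative G (at x) v"
proof -
  have "frechet_derivative G (at x) v = frechet_derivative G (at x) (\<Sum>b\<in>Basis. (v \<bullet> b) *\<^sub>R b)"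
    by (simp add: euclidean_representation)
  also have "\<dots> = (\<Sum>b\<in>Basis. (v \<bullet> b) * frechet_derivative G (at x) b)"
    by (simp add: linear_frechet_derivative[OF assms] linear_sum linear_scale)
  finally show ?thesis
    by (simp add: euclidean_gradient_def inner_sum_left inner_commute[of v] mult.commute)
qed

text \<open>\<open>H\<close> is the Hessian as an operator: \<open>H u \<bullet> v\<close> is the
  derivative in direction \<open>u\<close> of the directional derivative along \<open>v\<close>, so
  its symmetry is that of mixed second derivatives.\<close>

lemma euclidean_gradient_has_symmetric_derivative:
  assumes "smooth_on U G" "open U" "x \<in> U"
  shows "\<exists>H. (euclidean_gradient G has_derivative H) (at x) \<and> (\<forall>u v. H u \<bullet> v = H v \<bullet> u)"
proof -
  define D where "D y = frechet_derivative G (at y)" for y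
  define D2 where "D2 v y = frechet_derivative (\<lambda>y. D y v) (at y)" for v y
  have sm: "smooth_on U (\<lambda>y. D y v)" for v
    unfolding D_def by (rule smooth_on_frechet_derivative[OF assms(1,2)])
  have D: "(G has_derivative D y) (at y)" if "y \<in> U" for y
    unfolding D_def by (rule smooth_on_has_derivative[OF assms(1,2) that])
  have D2: "((\<lambda>y. D y v) has_derivative D2 v y) (at y)" if "y \<in> U" for v y
    unfolding D2_def by (rule smooth_on_has_derivative[OF sm assms(2) that])
  have "continuous_on U (\<lambda>y. D2 v y w)" for v w
    unfolding D2_def
    by (rule smooth_on_continuous_on[OF smooth_on_frechet_derivative[OF sm assms(2)]])
  then have sym: "D2 u x v = D2 v x u" for u v
    using second_derivative_symmetric[OF assms(2,3) D D2] by blast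
  define H where "H u = (\<Sum>b\<in>Basis. D2 b x u *\<^sub>R b)" for u
  have H: "(euclidean_gradient G has_derivative H) (at x)"
    unfolding euclidean_gradient_def[abs_def] H_def[abs_def] D_def[symmetric]
    by (intro has_derivative_sum has_derivative_scaleR_left D2 assms(3))
  have "H u \<bullet> v = D2 v x u" for u v
  proof -
    \<comment> \<open>Linearity is available in the last argument of \<open>D2\<close>, so symmetry
      is used to move the basis vector there.\<close>
    have "linear (D2 u x)" using has_derivative_linear[OF D2[OF assms(3)]] .
    then have "D2 u x v = (\<Sum>b\<in>Basis. (v \<bullet> b) * D2 u x b)"
      using linear_sum[of "D2 u x" "\<lambda>b. (v \<bullet> b) *\<^sub>R b" Basis]
      by (simp add: euclidean_representation linear_scale)
    then show ?thesis
      by (simp add: H_def inner_sum_left sym[of v] inner_commute[of v] mult.commute sym[of _ u])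
  qed
  then show ?thesis using H sym by auto
qed

section \<open>Slice charts and tangent spaces\<close>

definition slice_chart ::
    "nat \<Rightarrow> 'a::euclidean_space set \<Rightarrow> 'a set \<Rightarrow> 'a set \<Rightarrow> ('a \<Rightarrow> 'a) \<Rightarrow> ('a \<Rightarrow> 'a) \<Rightarrow> 'a set \<Rightarrow> bool" where
  "slice_chart k M U V \<phi> \<psi> L \<longleftrightarrow> open U \<and> open V \<and> homeomorphism U V \<phi> \<psi> \<and>
     smooth_on U \<phi> \<and> smooth_on V \<psi> \<and> subspace L \<and> dim L = k \<and> \<phi> ` (U \<inter> M) = V \<inter> L"

lemma smooth_submanifold_slice_chart:
  assumes "smooth_submanifold k M" "p \<in> M"
  obtains U V \<phi> \<psi> L where "slice_chart k M U V \<phi> \<psi> L" "p \<in> U"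
  using assms unfolding smooth_submanifold_def slice_chart_def by meson

lemma slice_chart_inverse:
  assumes "slice_chart k M U V \<phi> \<psi> L" "x \<in> U"
  shows "\<phi> x \<in> V" "\<psi> (\<phi> x) = x"
  using assms by (auto simp: slice_chart_def homeomorphism_def)

lemma slice_chart_inverse':
  assumes "slice_chart k M U V \<phi> \<psi> L" "y \<in> V"
  shows "\<psi> y \<in> U" "\<phi> (\<psi> y) = y"
  using assms by (auto simp: slice_chart_def homeomorphism_def)

text \<open>The slice condition compares images; injectivity of \<phi> on \<open>U\<close> makes it
  pointwise.\<close>

lemma slice_chart_mem_iff:
  assumes "slice_chart k M U V \<phi> \<psi> L" "x \<in> U"
  shows "x \<in> M \<longleftrightarrow> \<phi> x \<in> L"
proof
  assume "x \<in> M"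
  then show "\<phi> x \<in> L" using assms unfolding slice_chart_def by blast
next
  assume "\<phi> x \<in> L"
  then have "\<phi> x \<in> \<phi> ` (U \<inter> M)"
    using assms slice_chart_inverse(1)[OF assms] unfolding slice_chart_def by blast
  then show "x \<in> M"
    using slice_chart_inverse(2)[OF assms(1)] assms(2) by (metis Int_iff imageE)
qed

lemma slice_chart_has_derivative:
  assumes "slice_chart k M U V \<phi> \<psi> L" "x \<in> U"
  shows "(\<phi> has_derivative frechet_derivative \<phi> (at x)) (at x)"
    and "(\<psi> has_derivative frechet_derivative \<psi> (at (\<phi> x))) (at (\<phi> x))"
  using assms slice_chart_inverse(1)[OF assms] smooth_on_has_derivative
  unfolding slice_chart_def by blast+

text \<open>Chain rule for \<psi> after \<phi> and for \<phi> after \<psi>, which are the identity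
  on open sets.\<close>

lemma slice_chart_derivative_inverse:
  assumes "slice_chart k M U V \<phi> \<psi> L" "x \<in> U"
  shows "frechet_derivative \<psi> (at (\<phi> x)) (frechet_derivative \<phi> (at x) u) = u"
    and "frechet_derivative \<phi> (at x) (frechet_derivative \<psi> (at (\<phi> x)) w) = w"
proof -
  note d = slice_chart_has_derivative[OF assms]
  have op: "open U" "open V" using assms unfolding slice_chart_def by auto
  have "((\<lambda>x. \<psi> (\<phi> x)) has_derivative
      (\<lambda>u. frechet_derivative \<psi> (at (\<phi> x)) (frechet_derivative \<phi> (at x) u))) (at x)"
    by (rule has_derivative_compose[OF d])
  then have "((\<lambda>x. x) has_derivative
      (\<lambda>u. frechet_derivative \<psi> (at (\<phi> x)) (frechet_derivative \<phi> (at x) u))) (at x)"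
    by (rule has_derivative_transform_within_open[OF _ op(1) assms(2) slice_chart_inverse(2)[OF assms(1)]])
  from has_derivative_unique[OF this has_derivative_ident]
  show "frechet_derivative \<psi> (at (\<phi> x)) (frechet_derivative \<phi> (at x) u) = u"
    by (rule fun_cong)
  have "(\<phi> has_derivative frechet_derivative \<phi> (at x)) (at (\<psi> (\<phi> x)))"
    using d(1) slice_chart_inverse(2)[OF assms] by simp
  from has_derivative_compose[OF d(2) this]
  have "((\<lambda>y. y) has_derivative
      (\<lambda>w. frechet_derivative \<phi> (at x) (frechet_derivative \<psi> (at (\<phi> x)) w))) (at (\<phi> x))"
    by (rule has_derivative_transform_within_open[OF _ op(2) slice_chart_inverse(1)[OF assms]
          slice_chart_inverse'(2)[OF assms(1)]])
  from has_derivative_unique[OF this has_derivative_ident]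
  show "frechet_derivative \<phi> (at x) (frechet_derivative \<psi> (at (\<phi> x)) w) = w"
    by (rule fun_cong)
qed

text \<open>Used to replace a function along the curve by its expression in a chart or extension
  before differentiating at \<open>t\<close>.\<close>

lemma has_vector_derivative_within_imp_eventually_mem:
  assumes "(c has_vector_derivative v) (at t within I)" "open U" "c t \<in> U"
  obtains d where "d > 0" "\<And>s. \<lbrakk>s \<in> I; dist s t < d\<rbrakk> \<Longrightarrow> c s \<in> U"
proof -
  have "continuous (at t within I) c"
    using has_vector_derivative_continuous[OF assms(1)] .
  moreover obtain e where "e > 0" "ball (c t) e \<subseteq> U" using assms(2,3) openE by blast
  ultimately obtain d where "d > 0" "\<And>s. \<lbrakk>s \<in> I; dist s t < d\<rbrakk> \<Longrightarrow> dist (c s) (c t) < e"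
    unfolding continuous_within_eps_delta by blast
  then show ?thesis
    using that \<open>ball (c t) e \<subseteq> U\<close> by (metis dist_commute mem_ball subsetD)
qed

lemma has_vector_derivative_compose_has_derivative:
  assumes "(c has_vector_derivative v) (at t within I)" "(F has_derivative D) (at (c t))"
  shows "((\<lambda>s. F (c s)) has_vector_derivative D v) (at t within I)"
proof -
  have "((\<lambda>s. F (c s)) has_derivative (\<lambda>h. D (h *\<^sub>R v))) (at t within I)"
    using has_derivative_compose assms unfolding has_vector_derivative_def by blast
  then show ?thesis
    by (simp add: has_vector_derivative_def linear_scale[OF has_derivative_linear[OF assms(2)]])
qed

text \<open>For \<open>w\<close> orthogonal to \<open>L\<close>, the function
  \<open>\<phi> (c s) \<bullet> w\<close> vanishes for \<open>s\<close> near \<open>t\<close>, hence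
  so does its derivative. The image of the velocity therefore lies in the double orthogonal
  complement of \<open>L\<close>, which is \<open>L\<close>.\<close>

lemma slice_chart_velocity:
  assumes ch: "slice_chart k M U V \<phi> \<psi> L"
    and c: "(c has_vector_derivative v) (at t within I)" "c ` I \<subseteq> M" "t \<in> I"
    and I: "at t within I \<noteq> bot" and "c t \<in> U"
  shows "frechet_derivative \<phi> (at (c t)) v \<in> L"
proof -
  let ?D = "frechet_derivative \<phi> (at (c t)) v"
  have L: "subspace L" and U: "open U" using ch unfolding slice_chart_def by auto
  obtain d where d: "d > 0" "\<And>s. \<lbrakk>s \<in> I; dist s t < d\<rbrakk> \<Longrightarrow> c s \<in> U"
    using has_vector_derivative_within_imp_eventually_mem[OF c(1) U \<open>c t \<in> U\<close>] by blast
  have "?D \<bullet> w = 0" if "w \<in> L\<^sup>\<bottom>" for w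
  proof -
    have orth: "l \<bullet> w = 0" if "l \<in> L" for l
      using \<open>w \<in> L\<^sup>\<bottom>\<close> that by (auto simp: orthogonal_comp_def orthogonal_def)
    have "((\<lambda>s. \<phi> (c s) \<bullet> w) has_vector_derivative ?D \<bullet> w) (at t within I)"
      by (intro bounded_linear.has_vector_derivative[OF bounded_linear_inner_left]
          has_vector_derivative_compose_has_derivative[OF c(1)]
          slice_chart_has_derivative(1)[OF ch \<open>c t \<in> U\<close>])
    moreover have "\<phi> (c s) \<bullet> w = 0" if "s \<in> I" "dist s t < d" for s
    proof -
      have "c s \<in> M" using c(2) that(1) by blast
      then show ?thesis using slice_chart_mem_iff[OF ch d(2)[OF that]] orth by blast
    qed
    ultimately have "((\<lambda>s. 0) has_vector_derivative ?D \<bullet> w) (at t within I)"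
      using has_vector_derivative_transform_within[OF _ d(1) c(3), of "\<lambda>s. \<phi> (c s) \<bullet> w" _ "\<lambda>s. 0"]
      by blast
    then show ?thesis
      using vector_derivative_unique_within[OF I] has_vector_derivative_const by blast
  qed
  then have "?D \<in> L\<^sup>\<bottom>\<^sup>\<bottom>"
    by (auto simp: orthogonal_comp_def orthogonal_def inner_commute)
  then show ?thesis using orthogonal_comp_self[OF L] by simp
qed

text \<open>A straight line in \<open>L\<close> through \<open>\<phi> x\<close>, pulled back by
  \<psi>, stays in \<open>M\<close> for small \<open>t\<close> and has velocity \<open>u\<close> at
  0.\<close>

lemma slice_chart_line_germ:
  assumes ch: "slice_chart k M U V \<phi> \<psi> L"
    and x: "x \<in> U" "x \<in> M" and u: "frechet_derivative \<phi> (at x) u \<in> L"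
  shows "curve_germ M x u (\<lambda>t. \<psi> (\<phi> x + t *\<^sub>R frechet_derivative \<phi> (at x) u))"
proof -
  let ?w = "frechet_derivative \<phi> (at x) u"
  have V: "open V" and L: "subspace L" and sm: "smooth_on V \<psi>"
    using ch unfolding slice_chart_def by auto
  have xV: "\<phi> x \<in> V" using slice_chart_inverse(1)[OF ch x(1)] .
  have xL: "\<phi> x \<in> L" using slice_chart_mem_iff[OF ch x(1)] x(2) by blast
  obtain e where e: "e > 0" "ball (\<phi> x) e \<subseteq> V" using V xV openE by blast
  \<comment> \<open>The time interval is short enough for the line to stay in the ball; the summand
    1 covers \<open>?w = 0\<close>.\<close>
  define d where "d = e / (norm ?w + 1)"
  have pos: "norm ?w + 1 > 0" by (simp add: add_nonneg_pos)
  have d: "d > 0" using e pos by (simp add: d_def)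
  have mem: "\<phi> x + t *\<^sub>R ?w \<in> V" if "t \<in> {-d<..<d}" for t
  proof -
    have "\<bar>t\<bar> * norm ?w \<le> \<bar>t\<bar> * (norm ?w + 1)" by (intro mult_left_mono) auto
    also have "\<dots> < d * (norm ?w + 1)"
      using that pos by (intro mult_strict_right_mono) auto
    also have "\<dots> = e" using pos by (simp add: d_def)
    finally have "\<phi> x + t *\<^sub>R ?w \<in> ball (\<phi> x) e" by (simp add: dist_norm)
    then show ?thesis using e by blast
  qed
  have "smooth_on {-d<..<d} (\<lambda>t. \<psi> (\<phi> x + t *\<^sub>R ?w))"
    using Ck_on_compose_line[OF V open_greaterThanLessThan mem] sm unfolding smooth_on_def by blast
  moreover have "\<psi> (\<phi> x + t *\<^sub>R ?w) \<in> M" if "t \<in> {-d<..<d}" for t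
  proof -
    have "\<phi> x + t *\<^sub>R ?w \<in> L" using L xL u by (simp add: subspace_add subspace_scale)
    then show ?thesis
      using slice_chart_mem_iff[OF ch slice_chart_inverse'(1)[OF ch mem[OF that]]]
        slice_chart_inverse'(2)[OF ch mem[OF that]] by simp
  qed
  moreover have "((\<lambda>t. \<psi> (\<phi> x + t *\<^sub>R ?w)) has_vector_derivative u) (at 0)"
  proof -
    have "((\<lambda>t. \<phi> x + t *\<^sub>R ?w) has_vector_derivative ?w) (at 0)"
      by (auto intro!: derivative_eq_intros)
    from has_vector_derivative_compose_has_derivative[OF this]
      slice_chart_has_derivative(2)[OF ch x(1)] slice_chart_derivative_inverse(1)[OF ch x(1)]
    show ?thesis by fastforce
  qed
  ultimately show ?thesis
    unfolding curve_germ_def using d slice_chart_inverse(2)[OF ch x(1)] by auto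
qed

section \<open>Tangent spaces and tangential projection\<close>

text \<open>Velocities of curves in \<open>M\<close> are not visibly closed under addition; the
  chart exhibits them as the preimage of a linear subspace.\<close>

lemma slice_chart_tangent_space:
  assumes ch: "slice_chart k M U V \<phi> \<psi> L" and x: "x \<in> U" "x \<in> M"
  shows "tangent_space M x = {u. frechet_derivative \<phi> (at x) u \<in> L}"
proof (intro set_eqI iffI)
  fix u assume "u \<in> tangent_space M x"
  then obtain c e where c: "e > 0" "c ` {-e<..<e} \<subseteq> M" "c 0 = x"
      "(c has_vector_derivative u) (at 0)"
    unfolding tangent_space_def curve_germ_def by blast
  then have "at 0 within {-e<..<e} \<noteq> bot"
    by (simp add: at_within_open[of 0 "{-e<..<e}"])
  then have "frechet_derivative \<phi> (at (c 0)) u \<in> L"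
    using slice_chart_velocity[OF ch has_vector_derivative_at_within[OF c(4)] c(2)] c x by simp
  then show "u \<in> {u. frechet_derivative \<phi> (at x) u \<in> L}" using c by simp
next
  fix u assume "u \<in> {u. frechet_derivative \<phi> (at x) u \<in> L}"
  then show "u \<in> tangent_space M x"
    using slice_chart_line_germ[OF ch x] unfolding tangent_space_def by blast
qed

lemma tangent_space_subspace:
  assumes "smooth_submanifold k M" "p \<in> M"
  shows "subspace (tangent_space M p)"
proof -
  obtain U V \<phi> \<psi> L where ch: "slice_chart k M U V \<phi> \<psi> L" "p \<in> U"
    using smooth_submanifold_slice_chart[OF assms] .
  have "tangent_space M p = frechet_derivative \<phi> (at p) -` L"
    using slice_chart_tangent_space[OF ch assms(2)] by auto
  moreover have "subspace L" using ch unfolding slice_chart_def by auto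
  moreover have "linear (frechet_derivative \<phi> (at p))"
    using slice_chart_has_derivative(1)[OF ch] has_derivative_linear by blast
  ultimately show ?thesis by (simp add: linear_subspace_vimage)
qed

text \<open>The derivative of \<psi> maps \<open>L\<close> onto the tangent space and is injective,
  having the derivative of \<phi> as a left inverse.\<close>

lemma dim_tangent_space:
  assumes "smooth_submanifold k M" "p \<in> M"
  shows "dim (tangent_space M p) = k"
proof -
  obtain U V \<phi> \<psi> L where ch: "slice_chart k M U V \<phi> \<psi> L" "p \<in> U"
    using smooth_submanifold_slice_chart[OF assms] .
  let ?D = "frechet_derivative \<psi> (at (\<phi> p))"
  have "tangent_space M p = ?D ` L"
    unfolding slice_chart_tangent_space[OF ch assms(2)]
    using slice_chart_derivative_inverse[OF ch] by (auto simp: image_iff) metis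
  moreover have "linear ?D"
    using slice_chart_has_derivative(2)[OF ch] has_derivative_linear by blast
  moreover have "inj_on ?D (span L)"
    using slice_chart_derivative_inverse(2)[OF ch] by (metis inj_onI)
  ultimately show ?thesis
    using ch dim_image_eq unfolding slice_chart_def by metis
qed

text \<open>Tangent vectors are defined by smooth two-sided germs. This also admits end points of
  \<open>I\<close> and curves merely differentiable at \<open>t\<close>.\<close>

lemma velocity_in_tangent_space:
  assumes M: "smooth_submanifold k M"
    and c: "(c has_vector_derivative v) (at t within I)" "c ` I \<subseteq> M" "t \<in> I"
    and I: "at t within I \<noteq> bot"
  shows "v \<in> tangent_space M (c t)"
proof -
  have "c t \<in> M" using c by blast
  then obtain U V \<phi> \<psi> L where ch: "slice_chart k M U V \<phi> \<psi> L" "c t \<in> U"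
    using smooth_submanifold_slice_chart[OF M] by metis
  then show ?thesis
    using slice_chart_velocity[OF ch(1) c I] slice_chart_tangent_space[OF ch \<open>c t \<in> M\<close>] by blast
qed

text \<open>Justifies the definite description: orthogonal decomposition gives existence, and the
  difference of two candidates is orthogonal to itself.\<close>

lemma tangential_part_decomp:
  assumes "smooth_submanifold k M" "p \<in> M"
  shows "tangential_part M p w \<in> tangent_space M p"
    and "\<And>u. u \<in> tangent_space M p \<Longrightarrow> u \<bullet> tangential_part M p w = u \<bullet> w"
proof -
  let ?T = "tangent_space M p"
  let ?P = "\<lambda>v. v \<in> ?T \<and> (\<forall>u\<in>?T. (w - v) \<bullet> u = 0)"
  have S: "subspace ?T" using tangent_space_subspace[OF assms] .
  obtain y z where "y \<in> span ?T" "\<And>u. u \<in> span ?T \<Longrightarrow> orthogonal z u" "w = y + z"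
    using orthogonal_subspace_decomp_exists[of ?T w] by blast
  moreover have "span ?T = ?T" using S span_eq_iff by blast
  ultimately have y: "?P y" by (simp add: orthogonal_def)
  have "v = y" if v: "?P v" for v
  proof -
    have d: "v - y \<in> ?T" using v y S subspace_diff by blast
    have "(v - y) \<bullet> (v - y) = (w - y) \<bullet> (v - y) - (w - v) \<bullet> (v - y)"
      by (simp add: inner_diff_left)
    also have "\<dots> = 0" using v y d by simp
    finally show ?thesis by simp
  qed
  with y have "?P (tangential_part M p w)"
    unfolding tangential_part_def by (rule theI)
  then show "tangential_part M p w \<in> ?T"
    and "\<And>u. u \<in> ?T \<Longrightarrow> u \<bullet> tangential_part M p w = u \<bullet> w"
    by (auto simp: inner_diff_left inner_diff_right inner_commute)
qed

section \<open>Gradients of smooth functions on a submanifold\<close>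

text \<open>Subtracting \<open>\<phi> \<bullet> w\<close> with \<open>w\<close> orthogonal to the slice does not change the values on \<open>M\<close>,
  and a suitable \<open>w\<close> cancels the normal component of the gradient at \<open>p\<close>.\<close>

lemma adapted_extension:
  assumes M: "smooth_submanifold k M" and f: "smooth_map M f" and p: "p \<in> M"
  obtains U G where "open U" "p \<in> U" "smooth_on U G" "\<And>x. x \<in> U \<inter> M \<Longrightarrow> G x = f x"
    "euclidean_gradient G p \<in> tangent_space M p"
proof -
  obtain U0 G0 where 0: "open U0" "p \<in> U0" "smooth_on U0 G0" "\<And>x. x \<in> U0 \<inter> M \<Longrightarrow> G0 x = f x"
    using f[unfolded smooth_map_def, rule_format, OF p] by metis
  obtain U1 V \<phi> \<psi> L where ch: "slice_chart k M U1 V \<phi> \<psi> L" "p \<in> U1"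
    using smooth_submanifold_slice_chart[OF M p] .
  have U1: "open U1" "smooth_on U1 \<phi>" using ch unfolding slice_chart_def by auto
  let ?T = "tangent_space M p"
  let ?D\<phi> = "frechet_derivative \<phi> (at p)" and ?D\<psi> = "frechet_derivative \<psi> (at (\<phi> p))"
  obtain y z where y: "y \<in> span ?T" and z: "\<And>u. u \<in> span ?T \<Longrightarrow> orthogonal z u"
    and yz: "euclidean_gradient G0 p = y + z"
    using orthogonal_subspace_decomp_exists[of ?T "euclidean_gradient G0 p"] by blast
  \<comment> \<open>The adjoint transports the normal component \<open>z\<close> into the chart, so
    that \<open>\<phi> x \<bullet> w\<close> has Euclidean gradient \<open>z\<close> at
    \<open>p\<close>.\<close>
  define w where "w = adjoint ?D\<psi> z"
  have lin: "linear ?D\<psi>"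
    using slice_chart_has_derivative(2)[OF ch] has_derivative_linear by blast
  have w_inner: "l \<bullet> w = ?D\<psi> l \<bullet> z" for l
    unfolding w_def by (simp add: adjoint_works[OF lin])
  \<comment> \<open>The derivative of \<psi> maps \<open>L\<close> into the tangent space, to which
    \<open>z\<close> is orthogonal.\<close>
  have w_orth: "l \<bullet> w = 0" if "l \<in> L" for l
  proof -
    have "?D\<psi> l \<in> ?T"
      using that slice_chart_tangent_space[OF ch p] slice_chart_derivative_inverse(2)[OF ch] by simp
    from z[OF span_base[OF this]] show ?thesis
      by (simp add: w_inner orthogonal_def inner_commute)
  qed
  define U G where "U = U0 \<inter> U1" and "G x = G0 x - \<phi> x \<bullet> w" for x
  have U: "open U" "p \<in> U" "U \<subseteq> U0" "U \<subseteq> U1" using 0 U1 ch by (auto simp: U_def)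
  have "Ck_on n U G" for n
    unfolding G_def
  proof (rule Ck_on_diff[OF U(1)])
    show "Ck_on n U G0"
      using Ck_on_open_subset[OF 0(1) U(1) U(3)] 0(3) unfolding smooth_on_def by blast
    show "Ck_on n U (\<lambda>x. \<phi> x \<bullet> w)"
      using Ck_on_bounded_linear_compose[OF U(1) bounded_linear_inner_left]
        Ck_on_open_subset[OF U1(1) U(1) U(4)] U1(2) unfolding smooth_on_def by blast
  qed
  then have sm: "smooth_on U G" unfolding smooth_on_def by blast
  have "(G0 has_derivative frechet_derivative G0 (at p)) (at p)"
    by (rule smooth_on_has_derivative[OF 0(3,1,2)])
  then have dG: "(G has_derivative (\<lambda>u. frechet_derivative G0 (at p) u - ?D\<phi> u \<bullet> w)) (at p)"
    unfolding G_def[abs_def]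
    by (intro has_derivative_diff bounded_linear.has_derivative[OF bounded_linear_inner_left]
        slice_chart_has_derivative(1)[OF ch])
  have "euclidean_gradient G p \<bullet> u = y \<bullet> u" for u
  proof -
    have "euclidean_gradient G p \<bullet> u = frechet_derivative G0 (at p) u - ?D\<phi> u \<bullet> w"
      using euclidean_gradient_inner[OF differentiableI[OF dG]] frechet_derivative_at[OF dG] by metis
    also have "\<dots> = euclidean_gradient G0 p \<bullet> u - u \<bullet> z"
      using euclidean_gradient_inner[of G0 p u] smooth_on_has_derivative[OF 0(3,1,2)]
        slice_chart_derivative_inverse(1)[OF ch] by (simp add: w_inner differentiableI)
    finally show ?thesis by (simp add: yz inner_add_left inner_commute[of u z])
  qed
  then have "euclidean_gradient G p = y" by (metis vector_eq_rdot)
  then have "euclidean_gradient G p \<in> ?T"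
    using y tangent_space_subspace[OF M p] span_eq_iff by blast
  moreover have "G x = f x" if "x \<in> U \<inter> M" for x
  proof -
    have "\<phi> x \<in> L" using slice_chart_mem_iff[OF ch(1)] that U by blast
    then show ?thesis using 0(4)[of x] that U w_orth by (auto simp: G_def)
  qed
  ultimately show ?thesis using that U sm by blast
qed

text \<open>Along a curve in \<open>M\<close>, \<open>f\<close> agrees near \<open>t\<close> with
  \<open>G\<close>, to which the ambient chain rule applies.\<close>

lemma extension_derivative_along_curve:
  assumes G: "open U" "smooth_on U G" "\<And>x. x \<in> U \<inter> M \<Longrightarrow> G x = f x"
    and c: "(c has_vector_derivative v) (at t within I)" "c ` I \<subseteq> M" "t \<in> I" "c t \<in> U"
  shows "((\<lambda>s. f (c s)) has_vector_derivative euclidean_gradient G (c t) \<bullet> v) (at t within I)"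
proof -
  obtain d where d: "d > 0" "\<And>s. \<lbrakk>s \<in> I; dist s t < d\<rbrakk> \<Longrightarrow> c s \<in> U"
    using has_vector_derivative_within_imp_eventually_mem[OF c(1) G(1) c(4)] by blast
  have D: "(G has_derivative frechet_derivative G (at (c t))) (at (c t))"
    by (rule smooth_on_has_derivative[OF G(2,1) c(4)])
  from has_vector_derivative_compose_has_derivative[OF c(1) D]
  have "((\<lambda>s. G (c s)) has_vector_derivative euclidean_gradient G (c t) \<bullet> v) (at t within I)"
    by (simp add: euclidean_gradient_inner[OF differentiableI[OF D]])
  then show ?thesis
    by (rule has_vector_derivative_transform_within[OF _ d(1) c(3)]) (use G(3) d(2) c(2) in auto)
qed

lemma extension_derivative_along_germ:
  assumes G: "open U" "smooth_on U G" "\<And>x. x \<in> U \<inter> M \<Longrightarrow> G x = f x"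
    and p: "p \<in> U" and c: "curve_germ M p v c"
  shows "((\<lambda>t. f (c t)) has_real_derivative euclidean_gradient G p \<bullet> v) (at 0)"
proof -
  obtain e where e: "e > 0" "c ` {-e<..<e} \<subseteq> M" "c 0 = p" "(c has_vector_derivative v) (at 0)"
    using c unfolding curve_germ_def by blast
  have "((\<lambda>s. f (c s)) has_vector_derivative euclidean_gradient G (c 0) \<bullet> v)
      (at 0 within {-e<..<e})"
    using extension_derivative_along_curve[OF G has_vector_derivative_at_within[OF e(4)] e(2)]
      e p by auto
  then show ?thesis
    using e by (simp add: at_within_open[of 0 "{-e<..<e}"] has_real_derivative_iff_has_vector_derivative)
qed

text \<open>Justifies the definite description of \<open>grad\<close>. An extension with tangent
  Euclidean gradient gives existence; for uniqueness, the difference of two candidates is tangent,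
  so both can be tested on a germ with that velocity.\<close>

lemma grad_works:
  assumes M: "smooth_submanifold k M" and f: "smooth_map M f" and p: "p \<in> M"
  shows "grad M f p \<in> tangent_space M p"
    and "\<And>v c. curve_germ M p v c \<Longrightarrow>
      ((\<lambda>t. f (c t)) has_real_derivative grad M f p \<bullet> v) (at 0)"
proof -
  let ?T = "tangent_space M p"
  let ?P = "\<lambda>g. g \<in> ?T \<and>
    (\<forall>v c. curve_germ M p v c \<longrightarrow> ((\<lambda>t. f (c t)) has_real_derivative g \<bullet> v) (at 0))"
  obtain U G where G: "open U" "p \<in> U" "smooth_on U G" "\<And>x. x \<in> U \<inter> M \<Longrightarrow> G x = f x"
    "euclidean_gradient G p \<in> ?T"
    using adapted_extension[OF M f p] by blast
  have ex: "?P (euclidean_gradient G p)"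
    using G(5) extension_derivative_along_germ[OF G(1,3,4,2)] by blast
  have "g = euclidean_gradient G p" if g: "?P g" for g
  proof -
    let ?d = "g - euclidean_gradient G p"
    have "?d \<in> ?T" using g ex tangent_space_subspace[OF M p] subspace_diff by blast
    then obtain c where "curve_germ M p ?d c" unfolding tangent_space_def by blast
    then have "g \<bullet> ?d = euclidean_gradient G p \<bullet> ?d" using g ex DERIV_unique by blast
    then have "?d \<bullet> ?d = 0" by (simp add: inner_diff_left)
    then show ?thesis by simp
  qed
  with ex have "?P (grad M f p)" unfolding grad_def by (rule theI)
  then show "grad M f p \<in> ?T" and
    "\<And>v c. curve_germ M p v c \<Longrightarrow> ((\<lambda>t. f (c t)) has_real_derivative grad M f p \<bullet> v) (at 0)"
    by blast+
qed

text \<open>Both sides compute the derivative of \<open>f\<close> along a germ with velocity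
  \<open>v\<close>. The Euclidean gradient of \<open>G\<close> at \<open>x\<close> may have a normal
  component, as happens away from the point to which an extension is adapted.\<close>

lemma grad_inner_eq_extension:
  assumes M: "smooth_submanifold k M" and f: "smooth_map M f"
    and G: "open U" "smooth_on U G" "\<And>x. x \<in> U \<inter> M \<Longrightarrow> G x = f x"
    and x: "x \<in> U" "x \<in> M" and v: "v \<in> tangent_space M x"
  shows "grad M f x \<bullet> v = euclidean_gradient G x \<bullet> v"
proof -
  obtain c where "curve_germ M x v c" using v unfolding tangent_space_def by blast
  then show ?thesis
    using grad_works(2)[OF M f x(2)] extension_derivative_along_germ[OF G x(1)] DERIV_unique
    by blast
qed

text \<open>Since the Euclidean gradient of \<open>G\<close> at \<open>p\<close> is tangent to \<open>M\<close>, the Euclidean Hessian \<open>H\<close> of \<open>G\<close>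
  restricts to the Riemannian Hessian of \<open>f\<close> at \<open>p\<close>.\<close>

definition adapted_at ::
    "'a::euclidean_space set \<Rightarrow> ('a \<Rightarrow> real) \<Rightarrow> 'a \<Rightarrow> 'a set \<Rightarrow> ('a \<Rightarrow> real) \<Rightarrow> ('a \<Rightarrow> 'a) \<Rightarrow> bool" where
  "adapted_at M f p U G H \<longleftrightarrow> open U \<and> p \<in> U \<and> smooth_on U G \<and> (\<forall>x\<in>U \<inter> M. G x = f x) \<and>
     euclidean_gradient G p = grad M f p \<and>
     (euclidean_gradient G has_derivative H) (at p) \<and> (\<forall>u v. H u \<bullet> v = H v \<bullet> u)"

lemma adapted_at_exists:
  assumes M: "smooth_submanifold k M" and f: "smooth_map M f" and p: "p \<in> M"
  obtains U G H where "adapted_at M f p U G H"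
proof -
  obtain U G where G: "open U" "p \<in> U" "smooth_on U G" "\<And>x. x \<in> U \<inter> M \<Longrightarrow> G x = f x"
    "euclidean_gradient G p \<in> tangent_space M p"
    using adapted_extension[OF M f p] by blast
  \<comment> \<open>Both gradients are tangent at \<open>p\<close> and have equal products with
    tangent vectors, so their difference is orthogonal to itself.\<close>
  let ?d = "grad M f p - euclidean_gradient G p"
  have "?d \<in> tangent_space M p"
    using G(5) grad_works(1)[OF M f p] tangent_space_subspace[OF M p] subspace_diff by blast
  from grad_inner_eq_extension[OF M f G(1,3,4,2) p this]
  have "grad M f p \<bullet> ?d = euclidean_gradient G p \<bullet> ?d" .
  then have "?d \<bullet> ?d = 0" by (simp add: inner_diff_left)
  then have "euclidean_gradient G p = grad M f p" by simp
  then show ?thesis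
    using euclidean_gradient_has_symmetric_derivative[OF G(3,1,2)] G that
    unfolding adapted_at_def by blast
qed

text \<open>Carries the defining property of \<open>grad\<close> from germs at 0 to curves on any
  \<open>I\<close>, one-sided derivatives included.\<close>

lemma derivative_along_curve:
  assumes M: "smooth_submanifold k M" and f: "smooth_map M f"
    and c: "(c has_vector_derivative v) (at t within I)" "c ` I \<subseteq> M" "t \<in> I"
    and I: "at t within I \<noteq> bot"
  shows "((\<lambda>s. f (c s)) has_vector_derivative grad M f (c t) \<bullet> v) (at t within I)"
proof -
  have ct: "c t \<in> M" using c by blast
  obtain U G where G: "open U" "c t \<in> U" "smooth_on U G" "\<And>x. x \<in> U \<inter> M \<Longrightarrow> G x = f x"
    using adapted_extension[OF M f ct] by metis
  show ?thesis
    using extension_derivative_along_curve[OF G(1,3,4) c G(2)]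
      grad_inner_eq_extension[OF M f G(1,3,4,2) ct velocity_in_tangent_space[OF M c I]] by simp
qed

text \<open>Since \<open>X\<close> is tangent, \<open>grad M f\<close> may be replaced near
  \<open>t\<close> by the Euclidean gradient of \<open>G\<close>, for which the ordinary product
  rule holds. Being adapted matters only at \<open>c t\<close>, because \<open>X'\<close> need not
  be tangent.\<close>

lemma grad_inner_field_derivative:
  assumes M: "smooth_submanifold k M" and f: "smooth_map M f"
    and A: "adapted_at M f (c t) U G H"
    and c: "(c has_vector_derivative v) (at t within I)" "c ` I \<subseteq> M" "t \<in> I"
    and X: "(X has_vector_derivative X') (at t within I)"
      "\<And>s. s \<in> I \<Longrightarrow> X s \<in> tangent_space M (c s)"
  shows "((\<lambda>s. grad M f (c s) \<bullet> X s) has_vector_derivative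
      (grad M f (c t) \<bullet> X' + H v \<bullet> X t)) (at t within I)"
proof -
  have G: "open U" "c t \<in> U" "smooth_on U G" "\<And>x. x \<in> U \<inter> M \<Longrightarrow> G x = f x"
    "euclidean_gradient G (c t) = grad M f (c t)"
    "(euclidean_gradient G has_derivative H) (at (c t))"
    using A unfolding adapted_at_def by auto
  obtain d where d: "d > 0" "\<And>s. \<lbrakk>s \<in> I; dist s t < d\<rbrakk> \<Longrightarrow> c s \<in> U"
    using has_vector_derivative_within_imp_eventually_mem[OF c(1) G(1,2)] by blast
  have "((\<lambda>s. euclidean_gradient G (c s) \<bullet> X s) has_vector_derivative
      (euclidean_gradient G (c t) \<bullet> X' + H v \<bullet> X t)) (at t within I)"
    by (intro bounded_bilinear.has_vector_derivative[OF bounded_bilinear_inner]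
        has_vector_derivative_compose_has_derivative[OF c(1) G(6)] X(1))
  then have "((\<lambda>s. euclidean_gradient G (c s) \<bullet> X s) has_vector_derivative
      (grad M f (c t) \<bullet> X' + H v \<bullet> X t)) (at t within I)"
    by (simp add: G(5))
  then show ?thesis
  proof (rule has_vector_derivative_transform_within[OF _ d(1) c(3)])
    fix s assume s: "s \<in> I" "dist s t < d"
    then have "c s \<in> M" using c(2) by blast
    then show "euclidean_gradient G (c s) \<bullet> X s = grad M f (c s) \<bullet> X s"
      using grad_inner_eq_extension[OF M f G(1,3,4) d(2)[OF s] _ X(2)[OF s(1)]] by simp
  qed
qed

section \<open>Affine functions have parallel gradient\<close>

lemma velocity_has_vector_derivative:
  "smooth_on I c \<Longrightarrow> t \<in> I \<Longrightarrow> (c has_vector_derivative velocity I c t) (at t within I)"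
  unfolding velocity_def by (rule smooth_on_has_vector_derivative)

lemma smooth_on_velocity_UNIV:
  assumes "smooth_on UNIV c"
  shows "smooth_on UNIV (velocity UNIV c)"
proof -
  have "velocity UNIV c = (\<lambda>t. frechet_derivative c (at t) 1)"
    using smooth_on_differentiable[OF assms]
    by (auto simp: velocity_def frechet_derivative_eq_vector_derivative)
  then show ?thesis using smooth_on_frechet_derivative[OF assms] by simp
qed

text \<open>A vanishing covariant derivative says that the ambient acceleration is normal to
  \<open>M\<close>.\<close>

lemma geodesic_line_acceleration:
  assumes M: "smooth_submanifold k M" and c: "geodesic_line M c"
  shows "velocity UNIV c t \<in> tangent_space M (c t)"
    and "\<exists>w. (velocity UNIV c has_vector_derivative w) (at t) \<and>
      (\<forall>u\<in>tangent_space M (c t). u \<bullet> w = 0)"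
proof -
  have sm: "smooth_on UNIV c" and rg: "range c \<subseteq> M"
    and geo: "cov_deriv M UNIV c (velocity UNIV c) t = 0"
    using c unfolding geodesic_line_def by auto
  show "velocity UNIV c t \<in> tangent_space M (c t)"
    using velocity_in_tangent_space[OF M velocity_has_vector_derivative[OF sm] rg] by simp
  let ?w = "vector_derivative (velocity UNIV c) (at t)"
  have "(velocity UNIV c has_vector_derivative ?w) (at t)"
    using smooth_on_has_vector_derivative[OF smooth_on_velocity_UNIV[OF sm]] by simp
  moreover have "u \<bullet> ?w = 0" if "u \<in> tangent_space M (c t)" for u
    using tangential_part_decomp(2)[OF M _ that] geo rg unfolding cov_deriv_def
    by (metis inner_zero_right rangeI subsetD)
  ultimately show "\<exists>w. (velocity UNIV c has_vector_derivative w) (at t) \<and>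
      (\<forall>u\<in>tangent_space M (c t). u \<bullet> w = 0)" by blast
qed

text \<open>The velocity is tangent and the acceleration normal, so the squared speed has derivative
  zero. Hence a unit initial velocity yields a unit speed line, as \<open>affine_function\<close>
  demands.\<close>

lemma geodesic_line_constant_speed:
  assumes M: "smooth_submanifold k M" and c: "geodesic_line M c"
  shows "norm (velocity UNIV c t) = norm (velocity UNIV c 0)"
proof -
  let ?v = "velocity UNIV c"
  have "((\<lambda>t. ?v t \<bullet> ?v t) has_derivative (\<lambda>h. 0)) (at s)" for s
  proof -
    obtain w where w: "(?v has_vector_derivative w) (at s)" "?v s \<bullet> w = 0"
      using geodesic_line_acceleration[OF M c] by blast
    from bounded_bilinear.has_vector_derivative[OF bounded_bilinear_inner w(1) w(1)]
    show ?thesis using w(2) by (simp add: has_vector_derivative_def inner_commute)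
  qed
  then have "?v t \<bullet> ?v t = ?v 0 \<bullet> ?v 0"
    using has_derivative_zero_unique[of UNIV "\<lambda>t. ?v t \<bullet> ?v t" t 0] by simp
  then show ?thesis by (simp add: norm_eq_sqrt_inner)
qed

text \<open>Along the geodesic with initial velocity \<open>u\<close>, the product of
  \<open>grad M f\<close> with the velocity is the constant slope \<open>a\<close>. Its derivative
  at 0 is \<open>H u \<bullet> u\<close>, because the normal acceleration contributes
  nothing.\<close>

lemma affine_hessian_diagonal_zero:
  assumes M: "smooth_submanifold k M" and f: "smooth_map M f"
    and gc: "geodesically_complete M" and aff: "affine_function M f"
    and p: "p \<in> M" and A: "adapted_at M f p U G H"
    and u: "u \<in> tangent_space M p" "norm u = 1"
  shows "H u \<bullet> u = 0"
proof -
  obtain c where c: "geodesic_line M c" "c 0 = p" "velocity UNIV c 0 = u"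
    using gc p u(1) unfolding geodesically_complete_def by blast
  have sm: "smooth_on UNIV c" and rg: "range c \<subseteq> M"
    using c(1) unfolding geodesic_line_def by auto
  note hvd = velocity_has_vector_derivative[OF sm UNIV_I]
  have "unit_speed_geodesic_line M c"
    unfolding unit_speed_geodesic_line_def
    using c u(2) geodesic_line_constant_speed[OF M c(1)] by metis
  then obtain a b where ab: "\<And>s. f (c s) = a * s + b"
    using aff unfolding affine_function_def by blast
  have slope: "grad M f (c s) \<bullet> velocity UNIV c s = a" for s
  proof -
    have "((\<lambda>s. a * s + b) has_vector_derivative grad M f (c s) \<bullet> velocity UNIV c s) (at s)"
      using derivative_along_curve[OF M f hvd rg] by (simp add: ab)
    moreover have "((\<lambda>s. a * s + b) has_vector_derivative a) (at s)"
      by (auto intro!: derivative_eq_intros)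
    ultimately show ?thesis using vector_derivative_unique_at by blast
  qed
  obtain w where w: "(velocity UNIV c has_vector_derivative w) (at 0)"
    "\<And>v. v \<in> tangent_space M (c 0) \<Longrightarrow> v \<bullet> w = 0"
    using geodesic_line_acceleration(2)[OF M c(1)] by blast
  have "((\<lambda>s. grad M f (c s) \<bullet> velocity UNIV c s) has_vector_derivative
      (grad M f (c 0) \<bullet> w + H (velocity UNIV c 0) \<bullet> velocity UNIV c 0)) (at 0)"
    using grad_inner_field_derivative[OF M f _ hvd rg UNIV_I w(1)
        geodesic_line_acceleration(1)[OF M c(1)]] A c(2) by blast
  then have "((\<lambda>s. a) has_vector_derivative (grad M f p \<bullet> w + H u \<bullet> u)) (at (0::real))"
    by (simp add: slope c)
  then have "grad M f p \<bullet> w + H u \<bullet> u = 0"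
    using vector_derivative_unique_at has_vector_derivative_const by blast
  then show ?thesis
    using w(2)[of "grad M f p"] grad_works(1)[OF M f p] c(2) by simp
qed

text \<open>Scaling extends the diagonal case to all tangent vectors; polarization of the symmetric
  form does the rest.\<close>

lemma affine_hessian_zero:
  assumes M: "smooth_submanifold k M" and f: "smooth_map M f"
    and gc: "geodesically_complete M" and aff: "affine_function M f"
    and p: "p \<in> M" and A: "adapted_at M f p U G H"
    and u: "u \<in> tangent_space M p" and v: "v \<in> tangent_space M p"
  shows "H u \<bullet> v = 0"
proof -
  have lin: "linear H" and sym: "\<And>u v. H u \<bullet> v = H v \<bullet> u"
    using A has_derivative_linear unfolding adapted_at_def by blast+
  have sub: "subspace (tangent_space M p)" using tangent_space_subspace[OF M p] .
  have diag: "H w \<bullet> w = 0" if w: "w \<in> tangent_space M p" for w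
  proof (cases "w = 0")
    case True
    then show ?thesis by simp
  next
    case False
    have "H (w /\<^sub>R norm w) \<bullet> (w /\<^sub>R norm w) = 0"
      using affine_hessian_diagonal_zero[OF M f gc aff p A subspace_scale[OF sub w], of "inverse (norm w)"] False
      by simp
    then show ?thesis using False by (simp add: linear_scale[OF lin])
  qed
  have "H (u + v) \<bullet> (u + v) = 0" using diag sub u v by (simp add: subspace_add)
  then show ?thesis
    using diag[OF u] diag[OF v] sym[of u v]
    by (simp add: linear_add[OF lin] inner_add_left inner_add_right)
qed

text \<open>Parallelism in weak form: the Hessian term drops out of the product rule against tangent
  fields.\<close>

lemma affine_grad_parallel:
  assumes M: "smooth_submanifold k M" and f: "smooth_map M f"
    and gc: "geodesically_complete M" and aff: "affine_function M f"
    and c: "(c has_vector_derivative v) (at t within I)" "c ` I \<subseteq> M" "t \<in> I"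
    and I: "at t within I \<noteq> bot"
    and X: "(X has_vector_derivative X') (at t within I)"
      "\<And>s. s \<in> I \<Longrightarrow> X s \<in> tangent_space M (c s)"
  shows "((\<lambda>s. grad M f (c s) \<bullet> X s) has_vector_derivative grad M f (c t) \<bullet> X') (at t within I)"
proof -
  have ct: "c t \<in> M" using c by blast
  obtain U G H where A: "adapted_at M f (c t) U G H"
    using adapted_at_exists[OF M f ct] .
  have "H v \<bullet> X t = 0"
    using affine_hessian_zero[OF M f gc aff ct A velocity_in_tangent_space[OF M c I] X(2)[OF c(3)]] .
  then show ?thesis
    using grad_inner_field_derivative[where c = c, OF M f A c X] by simp
qed

section \<open>Constancy of the norm of the gradient\<close>

text \<open>Meant for the squared norm of \<open>grad M f\<close>, whose differentiability is not
  known in advance: bounds touching it at \<open>t\<close> with zero derivative force its derivative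
  to be zero.\<close>

lemma has_vector_derivative_zero_squeeze:
  fixes g :: "real \<Rightarrow> real"
  assumes lo: "(lo has_vector_derivative 0) (at t within I)" and hi: "(hi has_vector_derivative 0) (at t within I)"
    and d: "d > 0" "\<And>s. \<lbrakk>s \<in> I; dist s t < d\<rbrakk> \<Longrightarrow> lo s \<le> g s \<and> g s \<le> hi s"
    and eq: "lo t = g t" "hi t = g t"
  shows "(g has_vector_derivative 0) (at t within I)"
  unfolding has_vector_derivative_def has_derivative_within_alt
proof (intro conjI allI impI)
  show "bounded_linear (\<lambda>x::real. x *\<^sub>R (0::real))" by simp
  fix e :: real assume e: "e > 0"
  obtain d1 where d1: "d1 > 0" "\<And>s. s \<in> I \<Longrightarrow> norm (s - t) < d1 \<Longrightarrow> norm (lo s - lo t) \<le> e * norm (s - t)"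
    using lo e unfolding has_vector_derivative_def has_derivative_within_alt by auto
  obtain d2 where d2: "d2 > 0" "\<And>s. s \<in> I \<Longrightarrow> norm (s - t) < d2 \<Longrightarrow> norm (hi s - hi t) \<le> e * norm (s - t)"
    using hi e unfolding has_vector_derivative_def has_derivative_within_alt by auto
  show "\<exists>d>0. \<forall>s\<in>I. norm (s - t) < d \<longrightarrow> norm (g s - g t - (s - t) *\<^sub>R 0) \<le> e * norm (s - t)"
  proof (intro exI[of _ "min d (min d1 d2)"] conjI ballI impI)
    fix s assume s: "s \<in> I" "norm (s - t) < min d (min d1 d2)"
    then show "norm (g s - g t - (s - t) *\<^sub>R 0) \<le> e * norm (s - t)"
      using d1(2)[of s] d2(2)[of s] d(2)[of s] eq by (auto simp: dist_norm abs_le_iff)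
  qed (use d d1 d2 in auto)
qed

text \<open>The tangent fields \<open>X\<close> serve to bound \<open>\<bar>\<nabla>f\<bar>\<^sup>2\<close> from below by \<open>2\<langle>\<nabla>f, X\<rangle> - \<bar>X\<bar>\<^sup>2\<close>, with equality
  where \<open>X = \<nabla>f\<close>; this replaces differentiability of \<open>\<nabla>f\<close> itself.\<close>

definition framed_path :: "'a::euclidean_space set \<Rightarrow> (real \<Rightarrow> 'a) \<Rightarrow> bool" where
  "framed_path M c \<longleftrightarrow> c ` {0..1} \<subseteq> M \<and>
     (\<forall>t\<in>{0..1}. c differentiable (at t within {0..1}) \<and>
       (\<forall>u\<in>tangent_space M (c t). \<exists>X. X t = u \<and> X differentiable (at t within {0..1}) \<and>
         (\<forall>s\<in>{0..1}. X s \<in> tangent_space M (c s))))"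

text \<open>The lower bound comes from a tangent field \<open>X\<close> equal to the gradient at
  \<open>t\<close>, the upper bound from the Euclidean gradient of an adapted extension. Both touch
  at \<open>t\<close>; their derivatives vanish by weak parallelism and by the vanishing
  Hessian.\<close>

lemma affine_grad_norm_derivative:
  assumes M: "smooth_submanifold k M" and f: "smooth_map M f"
    and gc: "geodesically_complete M" and aff: "affine_function M f"
    and c: "framed_path M c" and t: "t \<in> {0..1}"
  shows "((\<lambda>s. grad M f (c s) \<bullet> grad M f (c s)) has_vector_derivative 0) (at t within {0..1})"
proof -
  let ?I = "{0..1::real}" and ?g = "\<lambda>s. grad M f (c s)"
  have I: "at t within ?I \<noteq> bot" using t by (simp add: trivial_limit_within islimpt_Icc)
  have cM: "c ` ?I \<subseteq> M" using c unfolding framed_path_def by blast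
  then have mem: "c s \<in> M" if "s \<in> ?I" for s using that by blast
  obtain v where v: "(c has_vector_derivative v) (at t within ?I)"
    using c t vector_derivative_works unfolding framed_path_def by blast
  obtain X where X: "X t = ?g t" "X differentiable (at t within ?I)"
    "\<And>s. s \<in> ?I \<Longrightarrow> X s \<in> tangent_space M (c s)"
    using c t grad_works(1)[OF M f mem[OF t]] unfolding framed_path_def by meson
  obtain X' where X': "(X has_vector_derivative X') (at t within ?I)"
    using X(2) vector_derivative_works by blast
  obtain U G H where A: "adapted_at M f (c t) U G H"
    using adapted_at_exists[OF M f mem[OF t]] .
  then have G: "open U" "c t \<in> U" "smooth_on U G" "\<And>x. x \<in> U \<inter> M \<Longrightarrow> G x = f x"
    "euclidean_gradient G (c t) = ?g t" "(euclidean_gradient G has_derivative H) (at (c t))"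
    unfolding adapted_at_def by auto
  obtain d where d: "d > 0" "\<And>s. \<lbrakk>s \<in> ?I; dist s t < d\<rbrakk> \<Longrightarrow> c s \<in> U"
    using has_vector_derivative_within_imp_eventually_mem[OF v G(1,2)] by blast
  let ?W = "\<lambda>s. euclidean_gradient G (c s)"
  have "((\<lambda>s. 2 * (?g s \<bullet> X s) - X s \<bullet> X s) has_vector_derivative
      2 * (?g t \<bullet> X') - (X t \<bullet> X' + X' \<bullet> X t)) (at t within ?I)"
    by (intro has_vector_derivative_diff bounded_bilinear.has_vector_derivative[OF bounded_bilinear_inner]
        bounded_linear.has_vector_derivative[OF bounded_linear_mult_right] X'
        affine_grad_parallel[OF M f gc aff v cM t I X' X(3)])
  then have lo: "((\<lambda>s. 2 * (?g s \<bullet> X s) - X s \<bullet> X s) has_vector_derivative 0) (at t within ?I)"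
    by (simp add: X(1) inner_commute)
  have Hv: "H v \<bullet> ?g t = 0"
    using affine_hessian_zero[OF M f gc aff mem[OF t] A velocity_in_tangent_space[OF M v cM t I]
        grad_works(1)[OF M f mem[OF t]]] .
  have "((\<lambda>s. ?W s \<bullet> ?W s) has_vector_derivative (?W t \<bullet> H v + H v \<bullet> ?W t)) (at t within ?I)"
    by (intro bounded_bilinear.has_vector_derivative[OF bounded_bilinear_inner]
        has_vector_derivative_compose_has_derivative[OF v G(6)])
  then have hi: "((\<lambda>s. ?W s \<bullet> ?W s) has_vector_derivative 0) (at t within ?I)"
    using Hv by (simp add: G(5) inner_commute)
  show ?thesis
  proof (rule has_vector_derivative_zero_squeeze[OF lo hi d(1)])
    fix s assume s: "s \<in> ?I" "dist s t < d"
    \<comment> \<open>\<open>?g s\<close> is the tangential part of \<open>?W s\<close>, so it is at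
      most as long; the lower bound is the square of \<open>?g s - X s\<close> being
      nonnegative.\<close>
    have "?g s \<bullet> ?g s = ?W s \<bullet> ?g s"
      using grad_inner_eq_extension[OF M f G(1,3,4) d(2)[OF s] mem[OF s(1)]]
        grad_works(1)[OF M f mem[OF s(1)]] by blast
    moreover have "(?W s - ?g s) \<bullet> (?W s - ?g s) \<ge> 0" "(?g s - X s) \<bullet> (?g s - X s) \<ge> 0"
      by simp_all
    ultimately show "2 * (?g s \<bullet> X s) - X s \<bullet> X s \<le> ?g s \<bullet> ?g s \<and> ?g s \<bullet> ?g s \<le> ?W s \<bullet> ?W s"
      by (simp add: inner_diff_left inner_diff_right inner_commute)
  qed (simp_all add: X(1) G(5))
qed

text \<open>In the chart the path is a segment in \<open>L\<close>, kept in \<open>V\<close> by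
  convexity of \<open>B\<close>; tangent vectors extend along it with constant coordinates.\<close>

lemma slice_chart_framed_path:
  assumes ch: "slice_chart k M U V \<phi> \<psi> L"
    and p: "p \<in> U" "p \<in> M" and q: "q \<in> U" "q \<in> M"
    and B: "\<phi> p \<in> B" "\<phi> q \<in> B" "convex B" "B \<subseteq> V"
  shows "framed_path M (\<lambda>s. \<psi> (\<phi> p + s *\<^sub>R (\<phi> q - \<phi> p)))"
proof -
  let ?I = "{0..1::real}"
  define y where "y s = \<phi> p + s *\<^sub>R (\<phi> q - \<phi> p)" for s
  have V: "open V" "smooth_on V \<psi>" and L: "subspace L" using ch unfolding slice_chart_def by auto
  have yB: "y s \<in> V" if "s \<in> ?I" for s
  proof -
    have "y s = (1 - s) *\<^sub>R \<phi> p + s *\<^sub>R \<phi> q" by (simp add: y_def algebra_simps)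
    then show ?thesis using that B convexD_alt[OF B(3,1,2), of s] by auto
  qed
  have yL: "y s \<in> L" for s
    using slice_chart_mem_iff[OF ch] p q L
    by (simp add: y_def subspace_add subspace_diff subspace_scale)
  have cU: "\<psi> (y s) \<in> U" "\<phi> (\<psi> (y s)) = y s" if "s \<in> ?I" for s
    using slice_chart_inverse'[OF ch yB[OF that]] by auto
  have cM: "\<psi> (y s) \<in> M" if "s \<in> ?I" for s
    using slice_chart_mem_iff[OF ch cU(1)[OF that]] cU(2)[OF that] yL by simp
  have yd: "(y has_vector_derivative (\<phi> q - \<phi> p)) (at t within ?I)" for t
    unfolding y_def[abs_def] by (auto intro!: derivative_eq_intros)
  have diff: "(\<lambda>s. F (y s)) differentiable (at t within ?I)"
    if "smooth_on V F" "t \<in> ?I" for F :: "'a \<Rightarrow> 'a" and t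
    using has_vector_derivative_compose_has_derivative[OF yd
        smooth_on_has_derivative[OF that(1) V(1) yB[OF that(2)]]]
      has_vector_derivative_def differentiable_def by blast
  show ?thesis
    unfolding framed_path_def y_def[symmetric]
  proof (intro conjI ballI)
    show "(\<lambda>s. \<psi> (y s)) ` ?I \<subseteq> M" using cM by blast
  next
    fix t assume t: "t \<in> ?I"
    show "(\<lambda>s. \<psi> (y s)) differentiable (at t within ?I)" using diff[OF V(2) t] .
  next
    fix t u assume t: "t \<in> ?I" and u: "u \<in> tangent_space M (\<psi> (y t))"
    define l where "l = frechet_derivative \<phi> (at (\<psi> (y t))) u"
    have l: "l \<in> L"
      using u slice_chart_tangent_space[OF ch cU(1)[OF t] cM[OF t]] by (simp add: l_def)
    let ?X = "\<lambda>s. frechet_derivative \<psi> (at (y s)) l"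
    have "?X t = u"
      using slice_chart_derivative_inverse(1)[OF ch cU(1)[OF t]] cU(2)[OF t] by (simp add: l_def)
    moreover have "?X differentiable (at t within ?I)"
      using diff[OF smooth_on_frechet_derivative[OF V(2,1)] t] .
    moreover have "?X s \<in> tangent_space M (\<psi> (y s))" if "s \<in> ?I" for s
      using slice_chart_tangent_space[OF ch cU(1)[OF that] cM[OF that]]
        slice_chart_derivative_inverse(2)[OF ch cU(1)[OF that]] cU(2)[OF that] l by simp
    ultimately show "\<exists>X. X t = u \<and> X differentiable (at t within ?I) \<and>
        (\<forall>s\<in>?I. X s \<in> tangent_space M (\<psi> (y s)))"
      by (intro exI[of _ ?X] conjI ballI)
  qed
qed

text \<open>Chart segments join \<open>p\<close> to every point of \<open>M\<close> in a chart ball,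
  so \<open>h\<close> is locally constant, and connectedness makes it constant.\<close>

lemma constant_on_if_derivative_along_framed_paths_zero:
  fixes h :: "'a::euclidean_space \<Rightarrow> real"
  assumes M: "smooth_submanifold k M" and conn: "connected M"
    and h: "\<And>c t. \<lbrakk>framed_path M c; t \<in> {0..1}\<rbrakk> \<Longrightarrow>
      ((\<lambda>s. h (c s)) has_vector_derivative 0) (at t within {0..1})"
  shows "h constant_on M"
proof (rule locally_constant_imp_constant[OF conn])
  fix p assume p: "p \<in> M"
  obtain U V \<phi> \<psi> L where ch: "slice_chart k M U V \<phi> \<psi> L" "p \<in> U"
    using smooth_submanifold_slice_chart[OF M p] .
  have U: "open U" "open V" "continuous_on U \<phi>"
    using ch(1) homeomorphism_cont1 unfolding slice_chart_def by blast+
  obtain e where e: "e > 0" "ball (\<phi> p) e \<subseteq> V"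
    using U(2) slice_chart_inverse(1)[OF ch] openE by blast
  let ?O = "U \<inter> \<phi> -` ball (\<phi> p) e"
  have "h q = h p" if q: "q \<in> M \<inter> ?O" for q
  proof -
    let ?c = "\<lambda>s::real. \<psi> (\<phi> p + s *\<^sub>R (\<phi> q - \<phi> p))"
    have "framed_path M ?c"
      using slice_chart_framed_path[OF ch p, of q "ball (\<phi> p) e"] q e by auto
    then have "h (?c 1) = h (?c 0)"
      using has_derivative_zero_unique[of "{0..1}" "\<lambda>s. h (?c s)" 1 0] h[of ?c]
      by (simp add: has_vector_derivative_def)
    then show ?thesis using slice_chart_inverse(2)[OF ch(1)] ch(2) q by simp
  qed
  moreover have "open ?O" using U continuous_open_preimage by blast
  then have "openin (top_of_set M) (M \<inter> ?O)" by (rule openin_open_Int)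
  moreover have "p \<in> M \<inter> ?O" using p ch(2) e(1) by simp
  ultimately show "\<exists>T. openin (top_of_set M) T \<and> p \<in> T \<and> (\<forall>x\<in>T. h x = h p)" by blast
qed

text \<open>A zero at one point would spread to all of \<open>M\<close> by constancy of the norm;
  then \<open>f\<close> would have zero derivative along all framed paths and be constant.\<close>

lemma affine_grad_nonzero:
  assumes M: "smooth_submanifold k M" and conn: "connected M" and f: "smooth_map M f"
    and gc: "geodesically_complete M" and aff: "affine_function M f"
    and nc: "\<not> f constant_on M" and p: "p \<in> M"
  shows "grad M f p \<noteq> 0"
proof
  assume 0: "grad M f p = 0"
  have "(\<lambda>x. grad M f x \<bullet> grad M f x) constant_on M"
    by (rule constant_on_if_derivative_along_framed_paths_zero[OF M conn
          affine_grad_norm_derivative[OF M f gc aff]])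
  then have zero: "grad M f x = 0" if "x \<in> M" for x
    using 0 p that unfolding constant_on_def by (metis inner_eq_zero_iff)
  have "f constant_on M"
  proof (rule constant_on_if_derivative_along_framed_paths_zero[OF M conn])
    fix c and t :: real assume c: "framed_path M c" and t: "t \<in> {0..1}"
    then obtain v where v: "(c has_vector_derivative v) (at t within {0..1})"
      using vector_derivative_works unfolding framed_path_def by blast
    have cM: "c ` {0..1} \<subseteq> M" using c unfolding framed_path_def by blast
    have "at t within {0..1} \<noteq> bot" using t by (simp add: trivial_limit_within islimpt_Icc)
    from derivative_along_curve[OF M f v cM t this]
    show "((\<lambda>s. f (c s)) has_vector_derivative 0) (at t within {0..1})"
      using zero cM t by (simp add: image_subset_iff)
  qed
  then show False using nc by blast
qed

section \<open>Eikonal helices\<close>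

text \<open>Three orthonormal vectors of \<open>S\<close> span it by dimension, and the remainder of
  the expansion is both in their span and orthogonal to it.\<close>

lemma orthonormal_expansion_dim_3:
  fixes S :: "'a::euclidean_space set"
  assumes S: "dim S = 3" and mem: "g \<in> S" "a \<in> S" "b \<in> S" "c \<in> S"
    and norm: "norm a = 1" "norm b = 1" "norm c = 1"
    and orth: "a \<bullet> b = 0" "a \<bullet> c = 0" "b \<bullet> c = 0"
  shows "g = (g \<bullet> a) *\<^sub>R a + (g \<bullet> b) *\<^sub>R b + (g \<bullet> c) *\<^sub>R c"
proof -
  have self: "a \<bullet> a = 1" "b \<bullet> b = 1" "c \<bullet> c = 1" using norm by (auto simp: norm_eq_1)
  have "a \<noteq> b" "a \<noteq> c" "b \<noteq> c" using self orth by auto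
  then have card: "card {a, b, c} = 3" by simp
  have "pairwise orthogonal {a, b, c}" "0 \<notin> {a, b, c}"
    using orth self by (auto simp: pairwise_def orthogonal_def inner_commute)
  then have "independent {a, b, c}" by (rule pairwise_orthogonal_independent)
  then have span: "S \<subseteq> span {a, b, c}"
    using card_ge_dim_independent[of "{a, b, c}" S] S mem card by simp
  let ?d = "g - ((g \<bullet> a) *\<^sub>R a + (g \<bullet> b) *\<^sub>R b + (g \<bullet> c) *\<^sub>R c)"
  have "orthogonal ?d x" if "x \<in> {a, b, c}" for x
    using that self orth
    by (auto simp: orthogonal_def inner_diff_left inner_add_left inner_commute[of b a]
        inner_commute[of c a] inner_commute[of c b])
  moreover have "?d \<in> span {a, b, c}"
    using span mem(1) by (intro span_diff span_add span_scale) (auto intro: span_base)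
  ultimately have "orthogonal ?d ?d" using orthogonal_to_span by blast
  then show ?thesis by (simp add: orthogonal_self)
qed

lemma has_vector_derivative_zero_imp_constant_on:
  fixes h :: "real \<Rightarrow> 'b::real_normed_vector"
  assumes "is_interval I" "\<And>t. t \<in> I \<Longrightarrow> (h has_vector_derivative 0) (at t within I)"
  shows "h constant_on I"
  using has_derivative_zero_constant[of I h] assms
  by (simp add: constant_on_def has_vector_derivative_def is_interval_convex)

theorem theorem4p1:
  fixes M :: "(real ^ 4) set"
    and X :: "'p topology" and A :: "(real ^ 2, 'p) rchart set"
    and f :: "real ^ 4 \<Rightarrow> real"
    and I :: "real set" and \<alpha> T Nn Bn :: "real \<Rightarrow> real ^ 4"
    and \<kappa> \<tau> :: "real \<Rightarrow> real"
  assumes "smooth_submanifold 3 M" and "M \<noteq> {}" and "connected M" and "geodesically_complete M"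
    and "riemannian_manifold X A" and "isometric_to_times_line M X A"
    and "smooth_map M f" and "affine_function M f" and "\<not> f constant_on M"
    and "eikonal_helix M f I \<alpha>"
    and "frenet_apparatus M I \<alpha> T Nn Bn \<kappa> \<tau>"
  shows "(\<exists>\<theta>. \<forall>t\<in>I. grad M f (\<alpha> t) =
            norm (grad M f (\<alpha> t)) *\<^sub>R (cos \<theta> *\<^sub>R T t + sin \<theta> *\<^sub>R Bn t))
       \<and> (\<lambda>t. \<tau> t / \<kappa> t) constant_on I"
proof -
  note M = assms(1) and f = assms(7)
  have curve: "is_interval I" "interior I \<noteq> {}" "smooth_on I \<alpha>" "\<alpha> ` I \<subseteq> M"
    and vel: "\<And>t. t \<in> I \<Longrightarrow> velocity I \<alpha> t \<noteq> 0"
    and helix: "(\<lambda>t. grad M f (\<alpha> t) \<bullet> unit_tangent I \<alpha> t) constant_on I"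
    using assms(10) unfolding eikonal_helix_def regular_curve_def by auto
  note frame = assms(11)[unfolded frenet_apparatus_def]
  have smooth: "smooth_on I T" "smooth_on I Nn" "smooth_on I Bn"
    using frame by blast+
  note frame_at = bspec[OF frame[THEN conjunct2, THEN conjunct2, THEN conjunct2]]
  have T: "T t = unit_tangent I \<alpha> t" if "t \<in> I" for t
    by (rule frame_at[OF that, THEN conjunct1])
  have tan: "Nn t \<in> tangent_space M (\<alpha> t)" "Bn t \<in> tangent_space M (\<alpha> t)"
    and normN: "norm (Nn t) = 1" and normB: "norm (Bn t) = 1"
    and orth: "T t \<bullet> Nn t = 0" "T t \<bullet> Bn t = 0" "Nn t \<bullet> Bn t = 0"
    and \<kappa>: "\<kappa> t > 0"
    and frenet: "nabla_T M I \<alpha> T t = \<kappa> t *\<^sub>R Nn t"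
      "nabla_T M I \<alpha> Nn t = - \<kappa> t *\<^sub>R T t + \<tau> t *\<^sub>R Bn t"
      "nabla_T M I \<alpha> Bn t = - \<tau> t *\<^sub>R Nn t"
    if "t \<in> I" for t
    by (simp_all only: frame_at[OF that, THEN conjunct2])
  have mem: "\<alpha> t \<in> M" if "t \<in> I" for t using curve(4) that by blast
  \<comment> \<open>An interval with interior points has no isolated points, so derivatives within
    \<open>I\<close> are unique.\<close>
  have bot: "at t within I \<noteq> bot" if "t \<in> I" for t
  proof -
    have "connected I" using curve(1) is_interval_connected by blast
    moreover have "I \<noteq> {x}" for x using curve(2) by auto
    ultimately have "t islimpt I"
      using connected_imp_perfect that by blast
    then show ?thesis by (simp add: trivial_limit_within)
  qed
  note \<alpha>' = velocity_has_vector_derivative[OF curve(3)]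
  have tanT: "T t \<in> tangent_space M (\<alpha> t)" if "t \<in> I" for t
    using velocity_in_tangent_space[OF M \<alpha>'[OF that] curve(4) that bot[OF that]]
      tangent_space_subspace[OF M mem[OF that]] T[OF that]
    by (simp add: unit_tangent_def subspace_scale)
  have normT: "norm (T t) = 1" if "t \<in> I" for t
    using T[OF that] vel[OF that] by (simp add: unit_tangent_def)
  let ?g = "\<lambda>t. grad M f (\<alpha> t)" and ?v = "\<lambda>t. norm (velocity I \<alpha> t)"
  \<comment> \<open>The factor \<open>?v t\<close> converts the arc length derivative
    \<open>nabla_T\<close> to the parameter \<open>t\<close>; only the tangential part of the
    ambient derivative counts because the gradient is tangent.\<close>
  have deriv: "((\<lambda>s. ?g s \<bullet> Y s) has_vector_derivative ?v t * (?g t \<bullet> nabla_T M I \<alpha> Y t))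
      (at t within I)"
    if "smooth_on I Y" "\<And>s. s \<in> I \<Longrightarrow> Y s \<in> tangent_space M (\<alpha> s)" "t \<in> I" for Y t
  proof -
    have "?g t \<bullet> vector_derivative Y (at t within I) = ?g t \<bullet> cov_deriv M I \<alpha> Y t"
      unfolding cov_deriv_def
      using tangential_part_decomp(2)[OF M mem[OF that(3)] grad_works(1)[OF M f mem[OF that(3)]]]
      by simp
    also have "\<dots> = ?v t * (?g t \<bullet> nabla_T M I \<alpha> Y t)"
      using vel[OF that(3)] by (simp add: nabla_T_def)
    finally have "?g t \<bullet> vector_derivative Y (at t within I) = ?v t * (?g t \<bullet> nabla_T M I \<alpha> Y t)" .
    with affine_grad_parallel[OF M f assms(4,8) \<alpha>'[OF that(3)] curve(4) that(3)
        bot[OF that(3)] smooth_on_has_vector_derivative[OF that(1,3)] that(2)]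
    show ?thesis by simp
  qed
  have zero: "D = 0" if "(h has_vector_derivative D) (at t within I)" "t \<in> I"
    "\<And>s. s \<in> I \<Longrightarrow> h s = k" for h :: "real \<Rightarrow> real" and D k t
  proof -
    have "((\<lambda>s. k) has_vector_derivative D) (at t within I)"
      using has_vector_derivative_transform[of t I "\<lambda>s. k" h D] that by simp
    then show ?thesis
      using vector_derivative_unique_within[OF bot[OF that(2)]] has_vector_derivative_const by blast
  qed
  obtain a where a: "\<And>t. t \<in> I \<Longrightarrow> ?g t \<bullet> T t = a"
    using helix T unfolding constant_on_def by metis
  \<comment> \<open>The product with \<open>T\<close> is constant, so its derivative, a positive
    multiple of the product with \<open>Nn\<close>, is zero.\<close>
  have gN: "?g t \<bullet> Nn t = 0" if "t \<in> I" for t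
    using zero[OF deriv[OF smooth(1) tanT that] that a] frenet(1)[OF that] \<kappa>[OF that] vel[OF that]
    by simp
  have "(\<lambda>t. ?g t \<bullet> Bn t) constant_on I"
  proof (rule has_vector_derivative_zero_imp_constant_on[OF curve(1)])
    fix t assume t: "t \<in> I"
    show "((\<lambda>t. ?g t \<bullet> Bn t) has_vector_derivative 0) (at t within I)"
      using deriv[OF smooth(3) tan(2) t] by (simp add: frenet(3)[OF t] gN[OF t])
  qed
  then obtain b where b: "\<And>t. t \<in> I \<Longrightarrow> ?g t \<bullet> Bn t = b"
    unfolding constant_on_def by blast
  \<comment> \<open>This is the derivative of the identity \<open>gN\<close>, read off with the
    second Frenet equation.\<close>
  have ratio: "\<kappa> t * a = \<tau> t * b" if "t \<in> I" for t
    using zero[OF deriv[OF smooth(2) tan(1) that] that gN] vel[OF that]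
    by (simp add: frenet(2)[OF that] inner_add_right inner_diff_right a[OF that] b[OF that])
  have g: "?g t = a *\<^sub>R T t + b *\<^sub>R Bn t" if "t \<in> I" for t
    using orthonormal_expansion_dim_3[OF dim_tangent_space[OF M mem[OF that]]
        grad_works(1)[OF M f mem[OF that]] tanT[OF that] tan[OF that] normT[OF that]
          normN[OF that] normB[OF that] orth[OF that]]
      a[OF that] b[OF that] gN[OF that] by simp
  have sq: "(norm (?g t))\<^sup>2 = a\<^sup>2 + b\<^sup>2" if "t \<in> I" for t
  proof -
    have "(norm (?g t))\<^sup>2 = ?g t \<bullet> (a *\<^sub>R T t + b *\<^sub>R Bn t)"
      using g[OF that] by (simp add: power2_norm_eq_inner)
    then show ?thesis
      by (simp add: inner_add_right a[OF that] b[OF that] power2_eq_square)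
  qed
  obtain t0 where t0: "t0 \<in> I" using curve(2) interior_subset by blast
  have nz: "?g t0 \<noteq> 0"
    by (rule affine_grad_nonzero[OF M assms(3) f assms(4,8,9) mem[OF t0]])
  \<comment> \<open>If \<open>b\<close> vanished, \<open>ratio\<close> and \<kappa> > 0 would make
    \<open>a\<close> vanish too, and with it the gradient.\<close>
  have b0: "b \<noteq> 0"
  proof
    assume "b = 0"
    then have "a = 0" using ratio[OF t0] \<kappa>[OF t0] by simp
    then show False using \<open>b = 0\<close> sq[OF t0] nz by simp
  qed
  \<comment> \<open>\<open>n\<close> is the norm of the gradient along the curve; dividing by it
    puts \<open>(a, b)\<close> on the unit circle, which yields one \<theta> for all
    \<open>t\<close>.\<close>
  define n where "n = sqrt (a\<^sup>2 + b\<^sup>2)"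
  have n: "n > 0" using b0 by (simp add: n_def sum_power2_gt_zero_iff)
  have gn: "norm (?g t) = n" if "t \<in> I" for t
    using sq[OF that] by (simp add: n_def real_sqrt_unique)
  have "(a / n)\<^sup>2 + (b / n)\<^sup>2 = (a\<^sup>2 + b\<^sup>2) / n\<^sup>2"
    by (simp add: power_divide add_divide_distrib)
  also have "a\<^sup>2 + b\<^sup>2 = n\<^sup>2" by (simp add: n_def)
  finally have "(a / n)\<^sup>2 + (b / n)\<^sup>2 = 1" using n by simp
  then obtain \<theta> where "a / n = cos \<theta>" "b / n = sin \<theta>" using sincos_total_2pi by blast
  then have "a = n * cos \<theta>" "b = n * sin \<theta>" using n by (simp_all add: field_simps)
  then have "\<forall>t\<in>I. ?g t = norm (?g t) *\<^sub>R (cos \<theta> *\<^sub>R T t + sin \<theta> *\<^sub>R Bn t)"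
    using g gn by (simp add: scaleR_add_right)
  moreover have "\<tau> t / \<kappa> t = a / b" if "t \<in> I" for t
    using ratio[OF that] \<kappa>[OF that] b0 by (simp add: field_simps)
  then have "(\<lambda>t. \<tau> t / \<kappa> t) constant_on I" unfolding constant_on_def by blast
  ultimately show ?thesis by blast
qed

end
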